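(* Let $n=3^k$ with $k\ge 1$, and let $E(n)$ be the number of equivalence classes of cubic MRS functions in $n$ variables. Then $$E(3^k)=3^{k-1}.$$ There is at least one equivalence class of size $d$ for every divisor $d\ne 2$ of $\varphi(n)=2\cdot 3^{k-1}$, and there is no class of size $2$. If $d=3^j$ with $0\le j\le k-1$, there is exactly one equivalence class of size $3^j$, and the least representative, in the lexicographical ordering of $D_n$, of this class is $$f_{j+1}=(1,\;3^{k-j-1}+1,\;2\cdot 3^{k-j-1}+1).$$ If $d=2\cdot 3^j$ with $1\le j\le k-1$, there are exactly $2\cdot 3^{j-1}-1$ equivalence classes of size $2\cdot 3^j$.
   Context: A Boolean function in $n$ variables is written in algebraic normal form as a polynomial over $GF(2)$ in $x_1,\dots,x_n$; indices are read modulo $n$ in $\{1,\dots,n\}$. A function is rotation symmetric if its algebraic normal form is unchanged by every cyclic shift of the variables. For pairwise distinct $1,j,k\in\{1,\dots,n\}$, the cubic monomial rotation symmetric (MRS) function $(1,j,k)$ is the sum of the distinct monomials among $x_{1+t}x_{j+t}x_{k+t}$, $t=0,\dots,n-1$. Several triples can represent the same function; $D_n$ is the set of triples $(1,j,k)$ with $1<j<k\le n$ obtained by choosing for each cubic MRS function its representation with least $j$ and, given that, least $k$. A permutation $\sigma$ of $\{1,\dots,n\}$ acts on functions by replacing each $x_i$ by $x_{\sigma(i)}$. It preserves rotation symmetry if $\sigma(f)$ is rotation symmetric for every cubic MRS function $f$ in $n$ variables. Two cubic MRS functions $f,g$ in $n$ variables are equivalent if $\sigma(f)=g$ for some permutation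 $\sigma$ which preserves rotation symmetry; the size of an equivalence class is the number of distinct functions in it. $\varphi$ is Euler's function. *)

theory Defs
  imports
    "HOL-Library.Poly_Mapping"
    "HOL-Library.Product_Lexorder"
    "HOL-Library.Z2"
    "HOL-Combinatorics.Permutations"
    "HOL-Number_Theory.Totient"
begin

text \<open>
  Boolean functions are represented by their algebraic normal form: a polynomial over
  \<open>GF(2)\<close> (the type \<^typ>\<open>bit\<close>) that is linear in every variable, i.e. a finitely supported family
  of coefficients indexed by square-free monomials. The set \<open>S\<close> of indices stands for the monomial
  \<open>\<Prod>i\<in>S. x\<^sub>i\<close>.
\<close>

type_synonym anf = "nat set \<Rightarrow>\<^sub>0 bit"

definition boolean_functions :: "nat \<Rightarrow> anf set" where
  "boolean_functions n = {f. \<forall>S \<in> Poly_Mapping.keys f. S \<subseteq> {1..n}}"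

definition monomial :: "nat set \<Rightarrow> anf" where
  "monomial S = Poly_Mapping.single S 1"

text \<open>Replacing each \<open>x\<^sub>i\<close> by \<open>x\<^bsub>\<sigma>(i)\<^esub>\<close>; only used for \<open>\<sigma>\<close> injective on the indices that occur.\<close>

definition subst_vars :: "(nat \<Rightarrow> nat) \<Rightarrow> anf \<Rightarrow> anf" where
  "subst_vars \<sigma> f =
     (\<Sum>S \<in> Poly_Mapping.keys f. Poly_Mapping.single (\<sigma> ` S) (Poly_Mapping.lookup f S))"

text \<open>The index \<open>i + t\<close> modulo \<open>n\<close> in \<open>{1..n}\<close>, for \<open>i \<ge> 1\<close>.\<close>

definition cyc_shift :: "nat \<Rightarrow> nat \<Rightarrow> nat \<Rightarrow> nat" where
  "cyc_shift n t i = (i + t - 1) mod n + 1"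

definition rotation_symmetric :: "nat \<Rightarrow> anf \<Rightarrow> bool" where
  "rotation_symmetric n f \<longleftrightarrow>
     f \<in> boolean_functions n \<and> (\<forall>t. subst_vars (cyc_shift n t) f = f)"

text \<open>The outer sum ranges over a set of monomials, so a monomial that arises from several
  shifts is counted once.\<close>

definition mrs :: "nat \<Rightarrow> nat \<times> nat \<times> nat \<Rightarrow> anf" where
  "mrs n = (\<lambda>(i, j, k).
     \<Sum>m \<in> {monomial {cyc_shift n t i, cyc_shift n t j, cyc_shift n t k} | t. t < n}. m)"

definition mrs_triples :: "nat \<Rightarrow> (nat \<times> nat \<times> nat) set" where
  "mrs_triples n = {(1, j, k) | j k. {1, j, k} \<subseteq> {1..n} \<and> 1 \<noteq> j \<and> 1 \<noteq> k \<and> j \<noteq> k}"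

definition cubic_mrs :: "nat \<Rightarrow> anf set" where
  "cubic_mrs n = mrs n ` mrs_triples n"

text \<open>The order on triples is the lexicographic one of \<^theory>\<open>HOL-Library.Product_Lexorder\<close>.\<close>

definition D :: "nat \<Rightarrow> (nat \<times> nat \<times> nat) set" where
  "D n = {(1, j, k) | j k. 1 < j \<and> j < k \<and> k \<le> n \<and>
     (\<forall>T \<in> mrs_triples n. mrs n T = mrs n (1, j, k) \<longrightarrow> (1, j, k) \<le> T)}"

definition preserves_rotation_symmetry :: "nat \<Rightarrow> (nat \<Rightarrow> nat) \<Rightarrow> bool" where
  "preserves_rotation_symmetry n \<sigma> \<longleftrightarrow>
     (\<forall>f \<in> cubic_mrs n. rotation_symmetric n (subst_vars \<sigma> f))"

definition mrs_equiv :: "nat \<Rightarrow> (anf \<times> anf) set" where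
  "mrs_equiv n = {(f, g). f \<in> cubic_mrs n \<and> g \<in> cubic_mrs n \<and>
     (\<exists>\<sigma>. \<sigma> permutes {1..n} \<and> preserves_rotation_symmetry n \<sigma> \<and> subst_vars \<sigma> f = g)}"

definition mrs_classes :: "nat \<Rightarrow> anf set set" where
  "mrs_classes n = cubic_mrs n // mrs_equiv n"

definition E :: "nat \<Rightarrow> nat" where
  "E n = card (mrs_classes n)"

definition least_representative :: "nat \<Rightarrow> anf set \<Rightarrow> nat \<times> nat \<times> nat \<Rightarrow> bool" where
  "least_representative n C T \<longleftrightarrow>
     T \<in> D n \<and> mrs n T \<in> C \<and> (\<forall>T' \<in> D n. mrs n T' \<in> C \<longrightarrow> T \<le> T')"

text \<open>
  Distinct algebraic normal forms are distinct functions on \<open>GF(2)\<^sup>n\<close>, and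
  \<^const>\<open>subst_vars\<close> is composition with the permutation of the arguments.
\<close>

definition anf_eval :: "anf \<Rightarrow> (nat \<Rightarrow> bit) \<Rightarrow> bit" where
  "anf_eval f x = (\<Sum>S \<in> Poly_Mapping.keys f. Poly_Mapping.lookup f S * (\<Prod>i\<in>S. x i))"

lemma anf_eval_superset:
  assumes "finite A" "Poly_Mapping.keys f \<subseteq> A"
  shows "anf_eval f x = (\<Sum>S\<in>A. Poly_Mapping.lookup f S * (\<Prod>i\<in>S. x i))"
  unfolding anf_eval_def
  by (rule sum.mono_neutral_left) (use assms in \<open>auto simp: in_keys_iff\<close>)

lemma anf_eval_add: "anf_eval (f + g) x = anf_eval f x + anf_eval g x"
proof -
  let ?A = "Poly_Mapping.keys f \<union> Poly_Mapping.keys g"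
  have "anf_eval (f + g) x = (\<Sum>S\<in>?A. Poly_Mapping.lookup (f + g) S * (\<Prod>i\<in>S. x i))"
    by (rule anf_eval_superset) (use Poly_Mapping.keys_add[of f g] in auto)
  moreover have "anf_eval f x = (\<Sum>S\<in>?A. Poly_Mapping.lookup f S * (\<Prod>i\<in>S. x i))"
    by (rule anf_eval_superset) auto
  moreover have "anf_eval g x = (\<Sum>S\<in>?A. Poly_Mapping.lookup g S * (\<Prod>i\<in>S. x i))"
    by (rule anf_eval_superset) auto
  ultimately show ?thesis
    by (simp only: lookup_add distrib_right sum.distrib)
qed

lemma anf_eval_zero [simp]: "anf_eval 0 x = 0"
  by (simp add: anf_eval_def)

lemma anf_eval_sum: "anf_eval (\<Sum>i\<in>I. f i) x = (\<Sum>i\<in>I. anf_eval (f i) x)"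
  by (induction I rule: infinite_finite_induct) (auto simp: anf_eval_add)

lemma anf_eval_single: "anf_eval (Poly_Mapping.single S c) x = c * (\<Prod>i\<in>S. x i)"
  by (cases "c = 0") (simp_all add: anf_eval_def)

lemma anf_eval_subst_vars:
  assumes "f \<in> boolean_functions n" and "inj_on \<sigma> {1..n}"
  shows "anf_eval (subst_vars \<sigma> f) x = anf_eval f (x \<circ> \<sigma>)"
proof -
  have "(\<Prod>i\<in>\<sigma> ` S. x i) = (\<Prod>i\<in>S. x (\<sigma> i))" if "S \<in> Poly_Mapping.keys f" for S
    using assms that
    by (subst prod.reindex) (auto simp: boolean_functions_def intro: inj_on_subset)
  then show ?thesis
    unfolding subst_vars_def anf_eval_sum anf_eval_single
    unfolding anf_eval_def by (intro sum.cong) auto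
qed

lemma anf_eval_eq_zeroD:
  assumes f: "f \<in> boolean_functions n"
    and eq: "\<And>x. anf_eval f x = 0"
  shows "f = 0"
proof (rule ccontr)
  assume "f \<noteq> 0"
  then have ne: "Poly_Mapping.keys f \<noteq> {}" by simp
  obtain S where S: "S \<in> Poly_Mapping.keys f"
    and min: "\<And>T. T \<in> Poly_Mapping.keys f \<Longrightarrow> T \<subseteq> S \<Longrightarrow> T = S"
    using finite_has_minimal[OF finite_keys ne] by metis
  define x :: "nat \<Rightarrow> bit" where "x i = (if i \<in> S then 1 else 0)" for i
  have fin: "finite T" if "T \<in> Poly_Mapping.keys f" for T
    using f that finite_subset[of T "{1..n}"] by (auto simp: boolean_functions_def)
  have "Poly_Mapping.lookup f T * (\<Prod>i\<in>T. x i) = (if T = S then 1 else 0)"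
    if T: "T \<in> Poly_Mapping.keys f" for T
  proof (cases "T = S")
    case True
    then have "Poly_Mapping.lookup f T \<noteq> 0" using S by (simp add: in_keys_iff)
    then show ?thesis using True by (simp add: x_def)
  next
    case False
    then obtain i where "i \<in> T" "i \<notin> S" using min T by blast
    then have "(\<Prod>i\<in>T. x i) = 0"
      using fin[OF T] by (intro prod_zero) (auto simp: x_def)
    then show ?thesis using False by simp
  qed
  then have "anf_eval f x = (\<Sum>T\<in>Poly_Mapping.keys f. if T = S then 1 else 0)"
    unfolding anf_eval_def by (intro sum.cong) auto
  also have "\<dots> = 1" using S by simp
  finally show False using eq by simp
qed

lemma anf_eval_inj:
  assumes f: "f \<in> boolean_functions n" and g: "g \<in> boolean_functions n"
    and eq: "\<And>x. anf_eval f x = anf_eval g x"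
  shows "f = g"
proof -
  have "Poly_Mapping.keys (f + g) \<subseteq> Poly_Mapping.keys f \<union> Poly_Mapping.keys g"
    by (rule Poly_Mapping.keys_add)
  then have "f + g \<in> boolean_functions n"
    using f g by (auto simp: boolean_functions_def)
  moreover have "anf_eval (f + g) x = 0" for x
    using eq[of x] by (simp add: anf_eval_add)
  ultimately have "f + g = 0" by (rule anf_eval_eq_zeroD)
  then have zero: "Poly_Mapping.lookup f S + Poly_Mapping.lookup g S = 0" for S
    by (metis lookup_add lookup_zero)
  have "Poly_Mapping.lookup f S = Poly_Mapping.lookup g S" for S
    using zero[of S] by (cases "Poly_Mapping.lookup f S"; cases "Poly_Mapping.lookup g S") auto
  then show ?thesis by (intro poly_mapping_eqI)
qed

end

theory Submission
  imports Defs
begin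

text \<open>
  Up to rotation a cubic monomial is a three-element subset \<open>{0, a, b}\<close> of \<open>\<int>/n\<close>, and a cubic MRS
  function is the translation orbit of such a set. If \<open>\<sigma>\<close> preserves rotation symmetry and \<open>c\<close> is
  the cyclic shift, then \<open>\<tau> = \<sigma>\<inverse> \<circ> c \<circ> \<sigma>\<close> maps every translation orbit of three-element sets to
  itself; for \<open>9 dvd n\<close> this forces \<open>\<tau>\<close> to be a translation, so \<open>\<sigma>\<close> is affine. Hence the
  equivalence classes are the orbits of the units \<open>u\<close> acting by \<open>(a, b) \<mapsto> (u a, u b)\<close>.

  For \<open>n = 3\<^sup>k\<close> let \<open>3\<^sup>m\<close> be the exact power of 3 dividing both \<open>a\<close> and \<open>b\<close>; only \<open>u\<close> modulo
  \<open>3\<^bsup>k-m\<^esup>\<close> matters. If \<open>u\<close> fixes the function then it permutes the three points: a transposition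
  forces \<open>u = -1\<close> and an arithmetic progression, and a 3-cycle would give \<open>9 dvd u\<^sup>2 + u + 1\<close>, which is
  impossible. So each level \<open>m\<close> has one class of size \<open>3\<^bsup>k-m-1\<^esup>\<close>, the arithmetic progressions, and all
  its other classes have size \<open>2 \<cdot> 3\<^bsup>k-m-1\<^esup>\<close>. Their number follows by counting the pairs \<open>(a, b)\<close>,
  six of which give the same function.
\<close>

section \<open>Cubic MRS functions as translation orbits\<close>

definition anf_of :: "nat set set \<Rightarrow> anf" where
  "anf_of \<S> = (\<Sum>S\<in>\<S>. monomial S)"

lemma lookup_anf_of:
  assumes "finite \<S>"
  shows "Poly_Mapping.lookup (anf_of \<S>) S = (if S \<in> \<S> then 1 else 0)"
proof -
  have "Poly_Mapping.lookup (anf_of \<S>) S = (\<Sum>T\<in>\<S>. if T = S then 1 else 0)"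
    unfolding anf_of_def monomial_def lookup_sum
    by (intro sum.cong) (auto simp: lookup_single when_def)
  then show ?thesis using assms by simp
qed

lemma keys_anf_of: "finite \<S> \<Longrightarrow> Poly_Mapping.keys (anf_of \<S>) = \<S>"
  by (auto simp: in_keys_iff lookup_anf_of split: if_splits)

text \<open>All coefficients lie in GF(2), so the support determines the polynomial. Questions about
  functions thereby become questions about families of index sets.\<close>

lemma anf_of_eq_iff: "finite \<S> \<Longrightarrow> finite \<T> \<Longrightarrow> anf_of \<S> = anf_of \<T> \<longleftrightarrow> \<S> = \<T>"
  by (metis keys_anf_of)

text \<open>If two monomials had the same image they would cancel over GF(2); injectivity on the
  family rules this out.\<close>

lemma subst_vars_anf_of:
  assumes "finite \<S>" "inj_on ((`) \<sigma>) \<S>"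
  shows "subst_vars \<sigma> (anf_of \<S>) = anf_of ((`) \<sigma> ` \<S>)"
proof -
  have "subst_vars \<sigma> (anf_of \<S>) = (\<Sum>S\<in>\<S>. monomial (\<sigma> ` S))"
    unfolding subst_vars_def keys_anf_of[OF assms(1)] monomial_def
    by (intro sum.cong) (auto simp: lookup_anf_of assms)
  then show ?thesis
    by (simp add: anf_of_def sum.reindex[OF assms(2)])
qed

text \<open>The residue \<open>0\<close> modulo \<open>n\<close> corresponds to the index 1, so differences of indices become residues.\<close>

definition idx :: "nat \<Rightarrow> int \<Rightarrow> nat" where
  "idx n x = nat (x mod int n) + 1"

text \<open>The parameter runs over all integers instead of residues, so that a change of base point
  is a plain reindexing of \<open>UNIV\<close>. Repetitions modulo \<open>n\<close> disappear in the
  set.\<close>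

definition orbit :: "nat \<Rightarrow> int \<Rightarrow> int \<Rightarrow> nat set set" where
  "orbit n a b = (\<lambda>t. idx n ` {t, t + a, t + b}) ` UNIV"

definition mrs_diff :: "nat \<Rightarrow> int \<Rightarrow> int \<Rightarrow> anf" where
  "mrs_diff n a b = anf_of (orbit n a b)"

definition distinct_diffs :: "nat \<Rightarrow> int \<Rightarrow> int \<Rightarrow> bool" where
  "distinct_diffs n a b \<longleftrightarrow>
     \<not> [a = 0] (mod int n) \<and> \<not> [b = 0] (mod int n) \<and> \<not> [a = b] (mod int n)"

text \<open>The differences \<open>(q - p, r - p)\<close> for the six orderings \<open>(p, q, r)\<close> of \<open>{0, a, b}\<close>.\<close>

definition variants :: "int \<Rightarrow> int \<Rightarrow> (int \<times> int) set" where
  "variants a b = {(a, b), (b, a), (- a, b - a), (b - a, - a), (- b, a - b), (a - b, - b)}"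

section \<open>Residues as indices, and when two orbits coincide\<close>

context
  fixes n :: nat
  assumes n: "n > 0"
begin

lemma idx_eq_iff: "idx n x = idx n y \<longleftrightarrow> [x = y] (mod int n)"
  using n by (auto simp: idx_def cong_def nat_eq_iff2)

lemma idx_in: "idx n x \<in> {1..n}"
  using n by (auto simp: idx_def nat_less_iff Suc_le_eq)

lemma idx_of_nat: "i \<in> {1..n} \<Longrightarrow> idx n (int i - 1) = i"
  by (auto simp: idx_def)

lemma range_idx: "range (idx n) = {1..n}"
  using idx_in idx_of_nat by (metis image_subset_iff rangeI subsetI subset_antisym)

lemma cyc_shift_idx: "cyc_shift n t (idx n x) = idx n (x + int t)"
proof -
  have "int ((nat (x mod int n) + t) mod n) = (x + int t) mod int n"
    using n by (simp add: zmod_int mod_add_left_eq)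
  then show ?thesis
    unfolding cyc_shift_def idx_def by (metis add_diff_cancel_right' add.assoc add.commute nat_int)
qed

lemma orbit_mem: "idx n ` {t, t + a, t + b} \<in> orbit n a b"
  by (auto simp: orbit_def)

lemma orbit_subset: "orbit n a b \<subseteq> Pow {1..n}"
  using idx_in by (auto simp: orbit_def)

lemma finite_orbit: "finite (orbit n a b)"
  using orbit_subset by (rule finite_subset) auto

lemma inj_on_image_Pow: "inj_on f A \<Longrightarrow> \<S> \<subseteq> Pow A \<Longrightarrow> inj_on ((`) f) \<S>"
  by (meson inj_on_image_Pow inj_on_subset)

lemma cyc_shift_inj: "inj_on (cyc_shift n t) {1..n}"
  unfolding range_idx[symmetric]
  by (auto simp: inj_on_def cyc_shift_idx idx_eq_iff cong_add_rcancel)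

text \<open>A cyclic shift is injective on the indices, so no monomials merge and only the support
  has to be compared.\<close>

lemma rotation_symmetric_anf_of:
  assumes "\<S> \<subseteq> Pow {1..n}"
  shows "rotation_symmetric n (anf_of \<S>) \<longleftrightarrow> (\<forall>t. (`) (cyc_shift n t) ` \<S> = \<S>)"
proof -
  have fin: "finite \<S>" using assms by (rule finite_subset) auto
  have "subst_vars (cyc_shift n t) (anf_of \<S>) = anf_of \<S> \<longleftrightarrow> (`) (cyc_shift n t) ` \<S> = \<S>" for t
    using fin by (simp add: subst_vars_anf_of inj_on_image_Pow[OF cyc_shift_inj assms] anf_of_eq_iff)
  moreover have "anf_of \<S> \<in> boolean_functions n"
    using assms fin by (auto simp: boolean_functions_def keys_anf_of)
  ultimately show ?thesis by (auto simp: rotation_symmetric_def)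
qed

lemma orbit_cyc_shift: "(`) (cyc_shift n t) ` orbit n a b = orbit n a b"
proof -
  have "(`) (cyc_shift n t) ` orbit n a b
      = (\<lambda>s. idx n ` {s, s + a, s + b}) ` range (\<lambda>s. s + int t)"
    by (simp add: orbit_def image_image cyc_shift_idx add.commute add.left_commute del: surj_plus_right surj_plus)
  also have "range (\<lambda>s. s + int t) = UNIV"
    by (simp add: surj_plus_right)
  finally show ?thesis by (simp add: orbit_def)
qed

lemma mrs_eq_mrs_diff:
  assumes "1 \<le> j" "1 \<le> l"
  shows "mrs n (1, j, l) = mrs_diff n (int j - 1) (int l - 1)"
proof -
  have cs: "cyc_shift n t i = idx n (int t + (int i - 1))" if "1 \<le> i" for t i
    using that n by (simp add: cyc_shift_def idx_def nat_mod_as_int algebra_simps of_nat_diff)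
  \<comment> \<open>The integer translations in \<open>orbit\<close> reduce to the shifts
    \<open>t < n\<close> in \<open>mrs\<close>.\<close>
  have "orbit n a b = (\<lambda>t. idx n ` {int t, int t + a, int t + b}) ` {..<n}" for a b
  proof -
    have "\<exists>t<n. idx n ` {s, s + a, s + b} = idx n ` {int t, int t + a, int t + b}" for s
    proof (intro exI conjI)
      show "nat (s mod int n) < n" using n by (simp add: nat_less_iff)
      have "idx n (s + x) = idx n (int (nat (s mod int n)) + x)" for x
        using n by (simp add: idx_eq_iff cong_def mod_add_left_eq)
      from this[of 0] this[of a] this[of b]
      show "idx n ` {s, s + a, s + b} = idx n ` {int (nat (s mod int n)),
          int (nat (s mod int n)) + a, int (nat (s mod int n)) + b}" by simp
    qed
    then have "idx n ` {s, s + a, s + b} \<in> (\<lambda>t. idx n ` {int t, int t + a, int t + b}) ` {..<n}" for s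
      by (metis (no_types, lifting) image_eqI lessThan_iff)
    then show ?thesis unfolding orbit_def by blast
  qed
  then have "{monomial {cyc_shift n t 1, cyc_shift n t j, cyc_shift n t l} | t. t < n}
      = monomial ` orbit n (int j - 1) (int l - 1)"
    using cs[of 1] cs[of j] cs[of l] assms by (auto simp: image_image)
  moreover have "inj_on monomial X" for X
    by (auto simp: inj_on_def monomial_def dest!: arg_cong[where f = Poly_Mapping.keys])
  ultimately show ?thesis
    by (simp add: mrs_def mrs_diff_def anf_of_def sum.reindex)
qed

lemma cubic_mrs_eq: "cubic_mrs n = {mrs_diff n a b | a b. distinct_diffs n a b}"
proof (intro set_eqI iffI)
  fix f assume "f \<in> cubic_mrs n"
  then obtain j l where jl: "j \<in> {1..n}" "l \<in> {1..n}" "1 \<noteq> j" "1 \<noteq> l" "j \<noteq> l"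
    and f: "f = mrs n (1, j, l)"
    by (auto simp: cubic_mrs_def mrs_triples_def)
  have "distinct_diffs n (int j - 1) (int l - 1)"
    using jl idx_of_nat[of j] idx_of_nat[of l] idx_of_nat[of 1] n
    unfolding distinct_diffs_def idx_eq_iff[symmetric] by auto
  then show "f \<in> {mrs_diff n a b | a b. distinct_diffs n a b}"
    using jl f mrs_eq_mrs_diff by auto
next
  fix f assume "f \<in> {mrs_diff n a b | a b. distinct_diffs n a b}"
  then obtain a b where d: "distinct_diffs n a b" and f: "f = mrs_diff n a b" by auto
  have i0: "idx n 0 = 1" by (simp add: idx_def)
  have "idx n (t + a) = idx n (t + (int (idx n a) - 1))" for t a
    using n by (simp add: idx_eq_iff cong_def mod_add_right_eq) (simp add: idx_def mod_add_right_eq)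
  then have "mrs_diff n a b = mrs_diff n (int (idx n a) - 1) (int (idx n b) - 1)"
    by (simp add: mrs_diff_def orbit_def)
  also have "\<dots> = mrs n (1, idx n a, idx n b)"
    using idx_in by (subst mrs_eq_mrs_diff) auto
  finally have "f = mrs n (1, idx n a, idx n b)" using f by simp
  moreover have "(1, idx n a, idx n b) \<in> mrs_triples n"
    using d idx_in n unfolding distinct_diffs_def idx_eq_iff[symmetric] i0 mrs_triples_def
    by auto
  ultimately show "f \<in> cubic_mrs n" by (auto simp: cubic_mrs_def)
qed

text \<open>Each of \<open>x\<close>, \<open>y\<close>, \<open>z\<close> is congruent to some entry
  on the right, and pairwise incongruent numbers use different entries, so the matching is one of
  the six permutations.\<close>

lemma idx_triple_eq:
  assumes "idx n ` {x, y, z} = idx n ` {p, q, r}"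
    and "\<not> [x = y] (mod int n)" "\<not> [x = z] (mod int n)" "\<not> [y = z] (mod int n)"
  shows "\<exists>p' q' r'. (p', q', r') \<in> {(p, q, r), (p, r, q), (q, p, r), (q, r, p), (r, p, q), (r, q, p)} \<and>
    [x = p'] (mod int n) \<and> [y = q'] (mod int n) \<and> [z = r'] (mod int n)"
proof -
  have "idx n x \<in> idx n ` {p, q, r}" "idx n y \<in> idx n ` {p, q, r}" "idx n z \<in> idx n ` {p, q, r}"
    unfolding assms(1)[symmetric] by auto
  then obtain p' q' r' where *: "p' \<in> {p, q, r}" "q' \<in> {p, q, r}" "r' \<in> {p, q, r}"
    and **: "idx n x = idx n p'" "idx n y = idx n q'" "idx n z = idx n r'"
    by blast
  then have "p' \<noteq> q'" "p' \<noteq> r'" "q' \<noteq> r'"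
    using assms(2-) unfolding idx_eq_iff[symmetric] by auto
  then have "(p', q', r') \<in> {(p, q, r), (p, r, q), (q, p, r), (q, r, p), (r, p, q), (r, q, p)}"
    using * by auto
  with ** show ?thesis unfolding idx_eq_iff[symmetric] by blast
qed

lemma orbit_cong:
  assumes "[a = a'] (mod int n)" "[b = b'] (mod int n)"
  shows "orbit n a b = orbit n a' b'"
proof -
  have "idx n (t + a) = idx n (t + a')" "idx n (t + b) = idx n (t + b')" for t
    using assms by (simp_all add: idx_eq_iff cong_add_lcancel)
  then show ?thesis by (simp add: orbit_def)
qed

lemma orbit_translate:
  assumes "{u, u + a, u + b} = {0, a', b'}"
  shows "orbit n a b = orbit n a' b'"
proof -
  have "{t, t + a, t + b} = {t - u, t - u + a', t - u + b'}" for t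
  proof -
    have "{t, t + a, t + b} = (\<lambda>x. x + (t - u)) ` {u, u + a, u + b}" by auto
    also have "\<dots> = {t - u, t - u + a', t - u + b'}" unfolding assms by (auto simp: algebra_simps)
    finally show ?thesis .
  qed
  then have "orbit n a b = (\<lambda>t. idx n ` {t, t + a', t + b'}) ` range (\<lambda>t. t - u)"
    unfolding orbit_def image_image by metis
  also have "range (\<lambda>t. t - u) = UNIV"
    by (rule surj_diff_right)
  finally show ?thesis by (simp add: orbit_def)
qed

lemma orbit_variants:
  assumes "(a', b') \<in> variants a b"
  shows "orbit n a b = orbit n a' b'"
proof -
  \<comment> \<open>The base point of the ordering is \<open>0\<close>, \<open>a\<close> or
    \<open>b\<close>; translating it to zero gives the set on the right.\<close>
  have "{0, 0 + a, 0 + b} = {0, a', b'} \<or> {- a, - a + a, - a + b} = {0, a', b'} \<or>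
      {- b, - b + a, - b + b} = {0, a', b'}"
    using assms by (auto simp: variants_def)
  then show ?thesis using orbit_translate by blast
qed

text \<open>If the orbits agree, \<open>{0, a', b'}\<close> matches a translate of
  \<open>{0, a, b}\<close> point by point. Subtracting the partner \<open>p\<close> of the base
  point leaves the differences for one of the six orderings.\<close>

lemma mrs_diff_eq_iff:
  assumes "distinct_diffs n a b" "distinct_diffs n a' b'"
  shows "mrs_diff n a b = mrs_diff n a' b' \<longleftrightarrow>
    (\<exists>(p, q) \<in> variants a b. [a' = p] (mod int n) \<and> [b' = q] (mod int n))"
proof
  assume "mrs_diff n a b = mrs_diff n a' b'"
  then have "orbit n a b = orbit n a' b'"
    by (simp add: mrs_diff_def anf_of_eq_iff finite_orbit)
  then have "idx n ` {0, a', b'} \<in> orbit n a b"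
    using orbit_mem[of 0 a' b'] by simp
  then obtain t where t: "idx n ` {0, a', b'} = idx n ` {t, t + a, t + b}"
    unfolding orbit_def by (elim imageE)
  have dist: "\<not> [0 = a'] (mod int n)" "\<not> [0 = b'] (mod int n)" "\<not> [a' = b'] (mod int n)"
    using assms(2) by (auto simp: distinct_diffs_def cong_sym_eq)
  obtain p q r where
    pqr: "(p, q, r) \<in> {(t, t + a, t + b), (t, t + b, t + a), (t + a, t, t + b),
      (t + a, t + b, t), (t + b, t, t + a), (t + b, t + a, t)}"
    and cong: "[0 = p] (mod int n)" "[a' = q] (mod int n)" "[b' = r] (mod int n)"
    using idx_triple_eq[OF t dist] by - (elim exE conjE, rule that)
  have "[a' = q - p] (mod int n)" "[b' = r - p] (mod int n)"
    using cong_diff[OF cong(2,1)] cong_diff[OF cong(3,1)] by simp_all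
  moreover have "(q - p, r - p) \<in> variants a b"
    using pqr by - (elim insertE emptyE Pair_inject; simp add: variants_def)
  ultimately show "\<exists>(p, q) \<in> variants a b. [a' = p] (mod int n) \<and> [b' = q] (mod int n)"
    by (intro bexI[of _ "(q - p, r - p)"]) simp_all
next
  assume "\<exists>(p, q) \<in> variants a b. [a' = p] (mod int n) \<and> [b' = q] (mod int n)"
  then obtain p q where "(p, q) \<in> variants a b" "[a' = p] (mod int n)" "[b' = q] (mod int n)"
    by auto
  then have "orbit n a b = orbit n a' b'"
    using orbit_variants[of p q a b] orbit_cong[of a' p b' q] by simp
  then show "mrs_diff n a b = mrs_diff n a' b'" by (simp add: mrs_diff_def)
qed

end

section \<open>Permutations preserving rotation symmetry are affine\<close>

context
  fixes n :: nat
  assumes n: "n > 0"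
begin

section \<open>Affine permutations and their action on orbits\<close>

lemma subst_vars_mrs_diff:
  assumes "inj_on \<sigma> {1..n}"
  shows "subst_vars \<sigma> (mrs_diff n a b) = anf_of ((`) \<sigma> ` orbit n a b)"
  unfolding mrs_diff_def
  by (intro subst_vars_anf_of finite_orbit[OF n] inj_on_image_Pow[OF n assms orbit_subset[OF n]])

text \<open>The set based at \<open>t\<close> goes to the set with scaled differences based at
  \<open>u * t + c\<close>. These base points need not exhaust the integers, but they meet every
  residue class because \<open>u\<close> is invertible modulo \<open>n\<close>.\<close>

lemma affine_image_orbit:
  assumes \<sigma>: "\<And>x. \<sigma> (idx n x) = idx n (u * x + c)" and u: "coprime u (int n)"
  shows "(`) \<sigma> ` orbit n a b = orbit n (u * a) (u * b)"
proof -
  have "(`) \<sigma> ` orbit n a b =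
      (\<lambda>s. idx n ` {s, s + u * a, s + u * b}) ` range (\<lambda>t. u * t + c)"
    by (simp add: orbit_def image_image \<sigma> algebra_simps)
  also have "\<dots> = orbit n (u * a) (u * b)"
  proof -
    obtain v where v: "[u * v = 1] (mod int n)"
      using u by (meson cong_solve_coprime_int)
    have "idx n ` {s, s + u * a, s + u * b} \<in>
        (\<lambda>s. idx n ` {s, s + u * a, s + u * b}) ` range (\<lambda>t. u * t + c)" for s
    proof -
      have "[u * (v * (s - c)) + c = 1 * (s - c) + c] (mod int n)"
        using cong_scalar_right[OF v, of "s - c"] by (intro cong_add) (auto simp: mult.assoc)
      then have s: "[s = u * (v * (s - c)) + c] (mod int n)"
        by (simp add: cong_sym_eq)
      have "idx n (s + x) = idx n (u * (v * (s - c)) + c + x)" for x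
        using cong_add[OF s cong_refl[of x]] by (simp only: idx_eq_iff[OF n])
      from this[of 0] this[of "u * a"] this[of "u * b"]
      have "idx n ` {s, s + u * a, s + u * b} = idx n ` {u * (v * (s - c)) + c,
          u * (v * (s - c)) + c + u * a, u * (v * (s - c)) + c + u * b}" by simp
      then show ?thesis by blast
    qed
    then show ?thesis unfolding orbit_def by blast
  qed
  finally show ?thesis .
qed

lemma mrs_equiv_scale:
  assumes d: "distinct_diffs n a b" and u: "coprime u (int n)"
  shows "distinct_diffs n (u * a) (u * b)"
    and "(mrs_diff n a b, mrs_diff n (u * a) (u * b)) \<in> mrs_equiv n"
proof -
  have scale: "distinct_diffs n (u * a) (u * b)" if "distinct_diffs n a b" for a b
    using that u cong_mult_lcancel[OF u, of a 0]  cong_mult_lcancel[OF u, of b 0]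
    by (auto simp: distinct_diffs_def cong_mult_lcancel)
  then show dd: "distinct_diffs n (u * a) (u * b)" using d by blast
  \<comment> \<open>Multiplication by \<open>u\<close> on residues, with the identity outside
    \<open>{1..n}\<close> as \<open>permutes\<close> demands.\<close>
  define \<sigma> where "\<sigma> i = (if i \<in> {1..n} then idx n (u * (int i - 1)) else i)" for i
  have \<sigma>: "\<sigma> (idx n x) = idx n (u * x + 0)" for x
  proof -
    have "\<sigma> (idx n x) = idx n (u * (x mod int n))"
      using n idx_in[OF n, of x] by (simp add: \<sigma>_def) (simp add: idx_def)
    then show ?thesis by (simp add: idx_eq_iff[OF n] cong_def mod_mult_right_eq)
  qed
  have inj: "inj_on \<sigma> {1..n}"
    unfolding range_idx[OF n, symmetric]
    by (auto simp: inj_on_def \<sigma> idx_eq_iff[OF n] cong_mult_lcancel[OF u])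
  moreover have "\<sigma> ` {1..n} \<subseteq> {1..n}" using idx_in[OF n] by (auto simp: \<sigma>_def)
  ultimately have "bij_betw \<sigma> {1..n} {1..n}"
    by (simp add: bij_betw_def endo_inj_surj)
  then have perm: "\<sigma> permutes {1..n}"
    by (rule bij_imp_permutes) (auto simp: \<sigma>_def)
  have subst_eq: "subst_vars \<sigma> (mrs_diff n a b) = mrs_diff n (u * a) (u * b)" for a b
    unfolding subst_vars_mrs_diff[OF inj] affine_image_orbit[OF \<sigma> u] by (simp add: mrs_diff_def)
  have "preserves_rotation_symmetry n \<sigma>"
    unfolding preserves_rotation_symmetry_def cubic_mrs_eq[OF n]
    using orbit_cyc_shift[OF n] orbit_subset[OF n]
    by (auto simp: subst_eq) (simp add: mrs_diff_def rotation_symmetric_anf_of[OF n])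
  then show "(mrs_diff n a b, mrs_diff n (u * a) (u * b)) \<in> mrs_equiv n"
    using d dd perm subst_eq unfolding mrs_equiv_def cubic_mrs_eq[OF n] by auto
qed

text \<open>
  The differences occurring in \<open>{0, 1, 2}\<close> and in \<open>{0, 1, 4}\<close> have only \<open>\<plusminus>1\<close> in common modulo 9, so
  \<open>\<tau>\<close> changes by \<open>\<plusminus>1\<close> at each step. A step \<open>-1\<close> is excluded by \<open>{0, 1, 3}\<close>, whose reflection is not a
  translate of it.
\<close>

lemma translation_if_orbits_preserved:
  fixes \<tau> :: "int \<Rightarrow> int"
  assumes nine: "9 dvd n"
    and inj: "\<And>x y. [\<tau> x = \<tau> y] (mod int n) \<Longrightarrow> [x = y] (mod int n)"
    and orb: "\<And>a b x. distinct_diffs n a b \<Longrightarrow>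
      \<exists>y. idx n ` {\<tau> x, \<tau> (x + a), \<tau> (x + b)} = idx n ` {y, y + a, y + b}"
  shows "[\<tau> (x + 1) = \<tau> x + 1] (mod int n)"
proof -
  have nine': "9 dvd int n" using nine by presburger
  have ncong: "\<not> [x = y] (mod int n)" if "\<not> 9 dvd x - y" for x y
    using that nine' by (meson cong_iff_dvd_diff dvd_trans)
  define \<delta> where "\<delta> x = \<tau> (x + 1) - \<tau> x" for x
  \<comment> \<open>Here \<open>p\<close>, \<open>q\<close>, \<open>r\<close> are the positions of
    the three image points inside the translate of \<open>{0, 1, b}\<close> that they form.\<close>
  have cases: "\<exists>p q r. (p, q, r) \<in> {(0, 1, b), (0, b, 1), (1, 0, b), (1, b, 0), (b, 0, 1), (b, 1, 0)} \<and>
      [\<delta> x = q - p] (mod int n) \<and> [\<tau> (x + b) - \<tau> x = r - p] (mod int n)"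
    if b: "b \<in> {2, 3, 4}" for b x
  proof -
    have d: "distinct_diffs n 1 b"
      unfolding distinct_diffs_def using b by (intro conjI ncong) auto
    have dist: "\<not> [\<tau> x = \<tau> (x + 1)] (mod int n)" "\<not> [\<tau> x = \<tau> (x + b)] (mod int n)"
      "\<not> [\<tau> (x + 1) = \<tau> (x + b)] (mod int n)"
      using inj b ncong[of x "x + 1"] ncong[of x "x + b"] ncong[of "x + 1" "x + b"] by fastforce+
    obtain y where "idx n ` {\<tau> x, \<tau> (x + 1), \<tau> (x + b)} = idx n ` {y, y + 1, y + b}"
      using orb[OF d] by blast
    from idx_triple_eq[OF n this dist] obtain p q r where
      pqr: "(p, q, r) \<in> {(y, y + 1, y + b), (y, y + b, y + 1), (y + 1, y, y + b),
        (y + 1, y + b, y), (y + b, y, y + 1), (y + b, y + 1, y)}"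
      and cong: "[\<tau> x = p] (mod int n)" "[\<tau> (x + 1) = q] (mod int n)" "[\<tau> (x + b) = r] (mod int n)"
      by (elim exE conjE)
    have "(p - y, q - y, r - y) \<in>
        {(0, 1, b), (0, b, 1), (1, 0, b), (1, b, 0), (b, 0, 1), (b, 1, 0)}"
      using pqr by - (elim insertE emptyE Pair_inject; simp)
    moreover have "[\<delta> x = (q - y) - (p - y)] (mod int n)"
      "[\<tau> (x + b) - \<tau> x = (r - y) - (p - y)] (mod int n)"
      using cong_diff[OF cong(2,1)] cong_diff[OF cong(3,1)] by (simp_all add: \<delta>_def)
    ultimately show ?thesis by blast
  qed
  have pm: "[\<delta> x = 1] (mod int n) \<or> [\<delta> x = - 1] (mod int n)" for x
  proof -
    obtain p q r where pqr: "(p, q, r) \<in> {(0, 1, 2), (0, 2, 1), (1, 0, 2), (1, 2, 0), (2, 0, 1), (2, 1, 0)}"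
      and c: "[\<delta> x = q - p] (mod int n)"
      using cases[of 2 x] by blast
    obtain p' q' r' where pqr': "(p', q', r') \<in> {(0, 1, 4), (0, 4, 1), (1, 0, 4), (1, 4, 0), (4, 0, 1), (4, 1, 0)}"
      and c': "[\<delta> x = q' - p'] (mod int n)"
      using cases[of 4 x] by blast
    have "[q - p = q' - p'] (mod int n)" using c c' by (metis cong_sym cong_trans)
    then have "9 dvd (q - p) - (q' - p')" using ncong by blast
    moreover have "q - p \<in> {1, 2, - 1, - 2}" "q' - p' \<in> {1, 4, - 1, 3, - 4, - 3}"
      using pqr pqr' by auto
    ultimately have "q - p = 1 \<or> q - p = - 1" by auto
    then show ?thesis using c by metis
  qed
  have mod9: "[x = y] (mod 9)" if "[x = y] (mod int n)" for x y
    using that nine' by (rule cong_dvd_modulus)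
  have "\<not> [\<delta> x = - 1] (mod int n)"
  proof
    assume m1: "[\<delta> x = - 1] (mod int n)"
    obtain p q r where pqr: "(p, q, r) \<in> {(0, 1, 3), (0, 3, 1), (1, 0, 3), (1, 3, 0), (3, 0, 1), (3, 1, 0)}"
      and c: "[\<delta> x = q - p] (mod int n)" "[\<tau> (x + 3) - \<tau> x = r - p] (mod int n)"
      using cases[of 3 x] by blast
    \<comment> \<open>Only the positions \<open>(1, 0, 3)\<close> have first difference
      \<open>-1\<close>, which makes the total over three steps equal to 2. But \<open>-1\<close>
      plus two further terms \<open>\<plusminus>1\<close> is \<open>-3\<close>, \<open>-1\<close> or
      \<open>1\<close>, and none of these is 2 modulo 9.\<close>
    have "[q - p = - 1] (mod int n)" using m1 c(1) by (metis cong_sym cong_trans)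
    then have "9 dvd q - p + 1" using ncong[of "q - p" "-1"] by auto
    then have "r - p = 2" using pqr by auto
    then have "[\<tau> (x + 3) - \<tau> x = 2] (mod int n)" using c(2) by simp
    moreover have "\<tau> (x + 3) - \<tau> x = \<delta> x + \<delta> (x + 1) + \<delta> (x + 2)"
      by (simp add: \<delta>_def add.assoc)
    ultimately have "[\<delta> x + \<delta> (x + 1) + \<delta> (x + 2) = 2] (mod 9)" by (metis mod9)
    moreover have "[\<delta> (x + 1) = 1] (mod 9) \<or> [\<delta> (x + 1) = - 1] (mod 9)"
      "[\<delta> (x + 2) = 1] (mod 9) \<or> [\<delta> (x + 2) = - 1] (mod 9)" "[\<delta> x = - 1] (mod 9)"
      using pm mod9 m1 by metis+
    ultimately show False unfolding cong_iff_dvd_diff by presburger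
  qed
  with pm[of x] have "[\<delta> x = 1] (mod int n)" by blast
  from cong_add[OF this cong_refl[of "\<tau> x"]] show ?thesis
    by (simp add: \<delta>_def add.commute)
qed

text \<open>Let \<open>s\<close> be \<open>\<sigma>\<close> on residues and \<open>\<tau>\<close>
  the conjugate by \<open>s\<close> of adding 1. Rotation symmetry of all images makes
  \<open>\<tau>\<close> preserve every orbit, so \<open>\<tau>\<close> is translation by some
  \<open>e\<close>. Then \<open>s\<close> grows by 1 whenever its argument grows by
  \<open>e\<close>, which makes it affine with slope the inverse of \<open>e\<close>.\<close>

lemma preserving_permutation_affine:
  assumes nine: "9 dvd n" and perm: "\<sigma> permutes {1..n}"
    and pres: "preserves_rotation_symmetry n \<sigma>"
  shows "\<exists>u c. coprime u (int n) \<and> (\<forall>x. \<sigma> (idx n x) = idx n (u * x + c))"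
proof -
  have inj: "inj_on \<sigma> {1..n}" using perm by (rule permutes_inj_on)
  define s where "s x = int (\<sigma> (idx n x)) - 1" for x
  have \<sigma>: "\<sigma> (idx n x) = idx n (s x)" for x
    using idx_of_nat[OF n] idx_in[OF n] perm unfolding s_def by (metis permutes_in_image)
  have s_iff: "[s x = s y] (mod int n) \<longleftrightarrow> [x = y] (mod int n)" for x y
    using inj idx_in[OF n] unfolding idx_eq_iff[OF n, symmetric] \<sigma>[symmetric] by (metis inj_on_eq_iff)
  have "\<exists>z. [s z = s x + 1] (mod int n)" for x
  proof -
    have "idx n (s x + 1) \<in> \<sigma> ` range (idx n)"
      unfolding range_idx[OF n] permutes_image[OF perm] by (rule idx_in[OF n])
    then show ?thesis by (auto simp: \<sigma> idx_eq_iff[OF n] cong_sym_eq)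
  qed
  then obtain \<tau> where \<tau>: "\<And>x. [s (\<tau> x) = s x + 1] (mod int n)" by metis
  have "[\<tau> (x + 1) = \<tau> x + 1] (mod int n)" for x
  proof (rule translation_if_orbits_preserved[OF nine])
    fix x y assume "[\<tau> x = \<tau> y] (mod int n)"
    then have "[s x + 1 = s y + 1] (mod int n)" using \<tau> by (metis s_iff cong_sym cong_trans)
    then show "[x = y] (mod int n)" by (simp add: cong_add_rcancel s_iff)
  next
    fix a b x assume d: "distinct_diffs n a b"
    let ?F = "(`) \<sigma> ` orbit n a b"
    have sub: "?F \<subseteq> Pow {1..n}" using orbit_subset[OF n, of a b] permutes_image[OF perm] by blast
    have "mrs_diff n a b \<in> cubic_mrs n"
      using d unfolding cubic_mrs_eq[OF n] by blast
    then have "rotation_symmetric n (subst_vars \<sigma> (mrs_diff n a b))"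
      using pres by (simp only: preserves_rotation_symmetry_def)
    then have "(`) (cyc_shift n 1) ` ?F = ?F"
      by (simp only: subst_vars_mrs_diff[OF inj] rotation_symmetric_anf_of[OF n sub])
    then have "cyc_shift n 1 ` \<sigma> ` idx n ` {x, x + a, x + b} \<in> ?F"
      using orbit_mem[OF n, of x a b] by (metis imageI)
    moreover have "cyc_shift n 1 ` \<sigma> ` idx n ` {x, x + a, x + b} =
        \<sigma> ` idx n ` {\<tau> x, \<tau> (x + a), \<tau> (x + b)}"
    proof -
      have "cyc_shift n 1 (\<sigma> (idx n x)) = \<sigma> (idx n (\<tau> x))" for x
        using cong_sym[OF \<tau>[of x]] by (simp add: \<sigma> cyc_shift_idx[OF n] idx_eq_iff[OF n])
      then show ?thesis by simp
    qed
    ultimately obtain y where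
      "\<sigma> ` idx n ` {\<tau> x, \<tau> (x + a), \<tau> (x + b)} = \<sigma> ` idx n ` {y, y + a, y + b}"
      unfolding orbit_def by (auto simp del: image_insert)
    then have "idx n ` {\<tau> x, \<tau> (x + a), \<tau> (x + b)} = idx n ` {y, y + a, y + b}"
      by (rule inj_on_image_eq_iff[OF inj, THEN iffD1, rotated 2]) (use idx_in[OF n] in auto)
    then show "\<exists>y. idx n ` {\<tau> x, \<tau> (x + a), \<tau> (x + b)} = idx n ` {y, y + a, y + b}" ..
  qed
  note step = this
  define e where "e = \<tau> 0"
  have transl: "[\<tau> x = x + e] (mod int n)" for x
  proof (induction x rule: int_induct[where k = 0])
    case base
    then show ?case by (simp add: e_def)
  next
    case (step1 i)
    from cong_trans[OF step cong_add[OF step1(2) cong_refl[of 1]]] show ?case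
      by (simp add: algebra_simps)
  next
    case (step2 i)
    from step[of "i - 1"] have "[\<tau> i = \<tau> (i - 1) + 1] (mod int n)" by simp
    from cong_diff[OF cong_trans[OF cong_sym[OF this] step2(2)] cong_refl[of 1]] show ?case
      by (simp add: algebra_simps)
  qed
  have step': "[s (x + e) = s x + 1] (mod int n)" for x
    using \<tau> transl s_iff by (meson cong_sym cong_trans)
  have s_nat: "[s (e * int i) = s 0 + int i] (mod int n)" for i
  proof (induction i)
    case (Suc i)
    from cong_trans[OF step' cong_add[OF Suc cong_refl[of 1]]] show ?case
      by (simp add: algebra_simps)
  qed simp
  \<comment> \<open>The induction covers natural multiples of \<open>e\<close>; a general integer is
    replaced by its residue.\<close>
  have s_mult: "[s (e * i) = s 0 + i] (mod int n)" for i
  proof -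
    define j where "j = nat (i mod int n)"
    have j: "int j = i mod int n" using n by (simp add: j_def)
    have "[e * i = e * int j] (mod int n)" unfolding j by (simp add: cong_def mod_mult_right_eq)
    moreover have "[s 0 + int j = s 0 + i] (mod int n)" unfolding j by (simp add: cong_def mod_add_right_eq)
    ultimately show ?thesis using s_nat[of j] s_iff by (meson cong_trans)
  qed
  have "[e * (s x - s 0) = x] (mod int n)" for x
    using s_mult[of "s x - s 0"] s_iff by simp
  note inv = this
  define u where "u = s 1 - s 0"
  have eu: "[e * u = 1] (mod int n)" using inv[of 1] by (simp add: u_def)
  then have cop: "coprime u (int n)" by (metis cong_imp_coprime cong_sym coprime_1_left coprime_mult_left_iff)
  have "[s x = u * x + s 0] (mod int n)" for x
  proof -
    have "[e * (u * x) = x] (mod int n)"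
      using cong_scalar_right[OF eu, of x] by (simp add: mult.assoc)
    then have "[s (e * (u * x)) = s x] (mod int n)" by (simp add: s_iff)
    then show ?thesis using s_mult[of "u * x"]
      by (metis add.commute cong_sym cong_trans)
  qed
  then show ?thesis using cop by (auto simp: \<sigma> idx_eq_iff[OF n])
qed

end

text \<open>The affine description covers the case \<open>9 dvd n\<close>. For \<open>n = 3\<close>
  there is a single cubic MRS function, and \<open>u = 1\<close> suffices.\<close>

lemma mrs_equiv_eq:
  assumes "n = 3 \<or> 9 dvd n" "n > 0"
  shows "mrs_equiv n = {(mrs_diff n a b, mrs_diff n (u * a) (u * b)) | a b u.
    distinct_diffs n a b \<and> coprime u (int n)}" (is "_ = ?R")
proof (intro subset_antisym subrelI)
  fix f g assume fg: "(f, g) \<in> mrs_equiv n"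
  obtain a b where f: "f = mrs_diff n a b" and d: "distinct_diffs n a b"
    using fg cubic_mrs_eq[OF assms(2)] unfolding mrs_equiv_def by auto
  obtain a' b' where g: "g = mrs_diff n a' b'" and d': "distinct_diffs n a' b'"
    using fg cubic_mrs_eq[OF assms(2)] unfolding mrs_equiv_def by auto
  show "(f, g) \<in> ?R"
    using assms(1)
  proof
    assume n: "n = 3"
    have "[a' = a] (mod 3) \<and> [b' = b] (mod 3) \<or> [a' = b] (mod 3) \<and> [b' = a] (mod 3)"
      using d d' unfolding n distinct_diffs_def cong_iff_dvd_diff of_nat_numeral by presburger
    then have "mrs_diff n a b = mrs_diff n a' b'"
      unfolding mrs_diff_eq_iff[OF assms(2) d d'] using n assms(2) by (auto simp: variants_def)
    then have "f = mrs_diff n a b \<and> g = mrs_diff n (1 * a) (1 * b)" using f g by simp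
    then show ?thesis using d coprime_1_left by blast
  next
    assume nine: "9 dvd n"
    obtain \<sigma> where \<sigma>: "\<sigma> permutes {1..n}" "preserves_rotation_symmetry n \<sigma>" "subst_vars \<sigma> f = g"
      using fg unfolding mrs_equiv_def by auto
    obtain u c where u: "coprime u (int n)" "\<And>x. \<sigma> (idx n x) = idx n (u * x + c)"
      using preserving_permutation_affine[OF assms(2) nine \<sigma>(1,2)] by blast
    have "g = mrs_diff n (u * a) (u * b)"
      using subst_vars_mrs_diff[OF assms(2) permutes_inj_on[OF \<sigma>(1)], of a b]
        affine_image_orbit[OF assms(2) u(2,1), of a b] \<sigma>(3) f
      by (simp add: mrs_diff_def)
    then show ?thesis using f d u(1) by blast
  qed
next
  fix f g assume "(f, g) \<in> ?R"
  then show "(f, g) \<in> mrs_equiv n" using mrs_equiv_scale[OF assms(2)] by auto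
qed

section \<open>The action of the units modulo a power of 3\<close>

lemma variants_cases:
  assumes "(p, q) \<in> variants a b"
  obtains "p = a" "q = b" | "p = b" "q = a" | "p = - a" "q = b - a"
    | "p = b - a" "q = - a" | "p = - b" "q = a - b" | "p = a - b" "q = - b"
  using assms unfolding variants_def by (elim insertE emptyE Pair_inject)

lemma variants_sym: "(p, q) \<in> variants a b \<Longrightarrow> (a, b) \<in> variants p q"
  by (elim variants_cases) (simp_all add: variants_def)

text \<open>The differences for one ordering are integer combinations of those for any
  other.\<close>

lemma variants_dvd:
  assumes "(p, q) \<in> variants a b"
  shows "d dvd p \<and> d dvd q \<longleftrightarrow> d dvd a \<and> d dvd b"
proof -
  have "d dvd p \<and> d dvd q" if "(p, q) \<in> variants a b" "d dvd a" "d dvd b" for a b p q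
    using that by (elim variants_cases) simp_all
  then show ?thesis using assms variants_sym by metis
qed

lemma variants_scale: "(p, q) \<in> variants a b \<Longrightarrow> (u * p, u * q) \<in> variants (u * a) (u * b)"
  by (elim variants_cases) (simp_all add: variants_def right_diff_distrib)

lemma variants_distinct_diffs:
  "(p, q) \<in> variants a b \<Longrightarrow> distinct_diffs n a b \<Longrightarrow> distinct_diffs n p q"
  by (elim variants_cases) (simp_all add: distinct_diffs_def cong_iff_dvd_diff dvd_diff_commute)

text \<open>The variants form one orbit of the symmetric group on the three points, so each member
  generates all of them.\<close>

lemma variants_trans:
  assumes "(p, q) \<in> variants a b"
  shows "variants p q = variants a b"
proof -
  have "variants p q \<subseteq> variants a b" if "(p, q) \<in> variants a b" for p q a b
    using that by (elim variants_cases) (auto simp: variants_def)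
  then show ?thesis using assms variants_sym by (metis subset_antisym)
qed

text \<open>The form equals \<open>(u - v)\<^sup>2 + 3 * (u * v)\<close>. Once 3 divides it, the
  square is divisible by 9, so 9 divides \<open>3 * (u * v)\<close>. This is what excludes
  3-cycles.\<close>

lemma nine_dvd_cyclotomic:
  fixes u v :: int
  assumes "9 dvd u\<^sup>2 + u * v + v\<^sup>2"
  shows "3 dvd u \<or> 3 dvd v"
proof -
  have eq: "u\<^sup>2 + u * v + v\<^sup>2 = (u - v)\<^sup>2 + 3 * (u * v)"
    by (simp add: power2_eq_square algebra_simps)
  have "3 dvd u\<^sup>2 + u * v + v\<^sup>2" by (rule dvd_trans[OF _ assms]) simp
  then have "3 dvd (u - v)\<^sup>2" unfolding eq by (simp add: dvd_add_left_iff)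
  then have "3 dvd u - v" by (rule prime_dvd_power[rotated]) simp
  then have "3\<^sup>2 dvd (u - v)\<^sup>2" by (rule dvd_power_same)
  then have "9 dvd 3 * (u * v)" using assms unfolding eq by (simp add: dvd_add_right_iff)
  then have "3 dvd u * v" by presburger
  then show ?thesis by (simp add: prime_dvd_mult_iff)
qed

lemma coprime_three_power: "\<not> 3 dvd u \<Longrightarrow> coprime (3 ^ i) (u::int)"
  by (intro coprime_power_left_iff[THEN iffD2] disjI1 prime_imp_coprime) simp_all

text \<open>The factors \<open>u - v\<close> and \<open>u + v\<close> add up to
  \<open>2 * u\<close>, so 3 cannot divide both, and the whole power falls to one of them.\<close>

lemma three_power_dvd_diff_squares:
  fixes u v :: int
  assumes "3 ^ r dvd u\<^sup>2 - v\<^sup>2" "\<not> 3 dvd u"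
  shows "3 ^ r dvd u - v \<or> 3 ^ r dvd u + v"
proof -
  have dvd: "3 ^ r dvd (u - v) * (u + v)"
    using assms(1) by (simp add: power2_eq_square algebra_simps)
  have "\<not> 3 dvd u - v \<or> \<not> 3 dvd u + v" using assms(2) by presburger
  then have "coprime (3 ^ r) (u - v) \<or> coprime (3 ^ r) (u + v)"
    using coprime_three_power by blast
  then show ?thesis using dvd by (metis coprime_dvd_mult_right_iff coprime_dvd_mult_left_iff)
qed

section \<open>The exact power of 3 common to both differences\<close>

definition has_level :: "nat \<Rightarrow> int \<Rightarrow> int \<Rightarrow> bool" where
  "has_level m a b \<longleftrightarrow> 3 ^ m dvd a \<and> 3 ^ m dvd b \<and> \<not> (3 ^ Suc m dvd a \<and> 3 ^ Suc m dvd b)"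

text \<open>One of \<open>a\<close> and \<open>b\<close> is \<open>3 ^ m\<close> times a number
  prime to 3, and that one alone permits the cancellation.\<close>

lemma has_level_cancel:
  assumes "has_level m a b" "m < k" "3 ^ k dvd c * a" "3 ^ k dvd c * b"
  shows "3 ^ (k - m) dvd c"
proof -
  have aux: "3 ^ (k - m) dvd c" if a: "3 ^ m dvd a" "\<not> 3 ^ Suc m dvd a" "3 ^ k dvd c * a" for a
  proof -
    obtain a' where a': "a = 3 ^ m * a'" using a(1) by (elim dvdE)
    have "(3::int) ^ k = 3 ^ m * 3 ^ (k - m)" using assms(2) by (simp flip: power_add)
    then have "3 ^ (k - m) dvd c * a'"
      using a(3) unfolding a' by (metis mult.left_commute dvd_times_left_cancel_iff power_not_zero zero_neq_numeral)
    moreover have "\<not> 3 dvd a'" using a(2) by (simp add: a' mult.commute)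
    then have "coprime (3 ^ (k - m)) a'" by (rule coprime_three_power)
    ultimately show ?thesis by (simp add: coprime_dvd_mult_left_iff)
  qed
  have "3 ^ m dvd a" "3 ^ m dvd b" "\<not> 3 ^ Suc m dvd a \<or> \<not> 3 ^ Suc m dvd b"
    using assms(1) by (auto simp: has_level_def)
  then show ?thesis using aux[of a] aux[of b] assms(3,4) by blast
qed

lemma has_level_scale:
  assumes "\<not> 3 dvd u"
  shows "has_level m (u * a) (u * b) \<longleftrightarrow> has_level m a b"
proof -
  have "coprime (3 ^ i) u" for i
    using assms by (rule coprime_three_power)
  then show ?thesis unfolding has_level_def by (simp only: coprime_dvd_mult_right_iff)
qed

locale three_power =
  fixes k n :: nat
  assumes k: "k \<ge> 1" and n: "n = 3 ^ k"
begin

lemma n_pos: "n > 0" by (simp add: n)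

lemma int_n: "int n = 3 ^ k" by (simp add: n)

lemma coprime_n_iff: "coprime u (int n) \<longleftrightarrow> \<not> 3 dvd u"
proof
  assume "coprime u (int n)"
  moreover have "3 dvd int n" using k by (simp add: int_n dvd_power)
  ultimately show "\<not> 3 dvd u" using coprime_common_divisor[of u "int n" 3] by auto
next
  assume "\<not> 3 dvd u"
  then show "coprime u (int n)"
    unfolding int_n by (subst coprime_commute) (rule coprime_three_power)
qed

lemmas diff_eq_iff = mrs_diff_eq_iff[OF n_pos]

lemma mrs_equiv_iff:
  "(f, g) \<in> mrs_equiv n \<longleftrightarrow> (\<exists>a b u. distinct_diffs n a b \<and> \<not> 3 dvd u \<and>
     f = mrs_diff n a b \<and> g = mrs_diff n (u * a) (u * b))"
proof -
  have "k = 1 \<or> (\<exists>i. k = i + 2)" using k by presburger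
  then have "n = 3 \<or> 9 dvd n" by (auto simp: n power_add)
  from mrs_equiv_eq[OF this n_pos] show ?thesis
    by (auto simp: coprime_n_iff)
qed

lemma diff_scale:
  assumes "distinct_diffs n a b" "\<not> 3 dvd u"
  shows "distinct_diffs n (u * a) (u * b)"
  using mrs_equiv_scale(1)[OF n_pos] assms coprime_n_iff by blast

lemma diff_eq_scale:
  assumes "distinct_diffs n a b" "distinct_diffs n a' b'" "\<not> 3 dvd u"
    "mrs_diff n a b = mrs_diff n a' b'"
  shows "mrs_diff n (u * a) (u * b) = mrs_diff n (u * a') (u * b')"
proof -
  obtain p q where "(p, q) \<in> variants a b" "[a' = p] (mod int n)" "[b' = q] (mod int n)"
    using assms(4) unfolding diff_eq_iff[OF assms(1,2)] by blast
  then have "(u * p, u * q) \<in> variants (u * a) (u * b)"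
    "[u * a' = u * p] (mod int n)" "[u * b' = u * q] (mod int n)"
    using variants_scale by (auto intro: cong_scalar_left)
  then show ?thesis
    unfolding diff_eq_iff[OF diff_scale[OF assms(1,3)] diff_scale[OF assms(2,3)]]
    by (intro bexI[of _ "(u * p, u * q)"]) simp_all
qed

lemma mrs_diff_cong:
  "[a = a'] (mod int n) \<Longrightarrow> [b = b'] (mod int n) \<Longrightarrow> mrs_diff n a b = mrs_diff n a' b'"
  using orbit_cong[OF n_pos] by (simp add: mrs_diff_def)

lemma mrs_diff_variants: "(p, q) \<in> variants a b \<Longrightarrow> mrs_diff n a b = mrs_diff n p q"
  using orbit_variants[OF n_pos] by (simp add: mrs_diff_def)

section \<open>Equivalence classes as orbits of units\<close>

definition scale_class :: "int \<Rightarrow> int \<Rightarrow> anf set" where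
  "scale_class a b = (\<lambda>u. mrs_diff n (u * a) (u * b)) ` {u. \<not> 3 dvd u}"

lemma scale_class_self: "mrs_diff n a b \<in> scale_class a b"
  unfolding scale_class_def by (rule image_eqI[of _ _ 1]) simp_all

lemma scale_class_eqI:
  assumes "distinct_diffs n a b" "distinct_diffs n a' b'" "mrs_diff n a b = mrs_diff n a' b'"
  shows "scale_class a b = scale_class a' b'"
  unfolding scale_class_def by (rule image_cong) (auto intro: diff_eq_scale assms)

text \<open>Scaling by a unit can only shrink the orbit; applying this also to an inverse
  \<open>v\<close> of \<open>u\<close> modulo \<open>n\<close> gives the other inclusion.\<close>

lemma scale_class_scale:
  assumes "\<not> 3 dvd u"
  shows "scale_class (u * a) (u * b) = scale_class a b"
proof -
  have sub: "scale_class (u * a) (u * b) \<subseteq> scale_class a b" if u: "\<not> 3 dvd u" for u a b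
  proof
    fix f assume "f \<in> scale_class (u * a) (u * b)"
    then obtain t where t: "\<not> 3 dvd t" "f = mrs_diff n (t * (u * a)) (t * (u * b))"
      unfolding scale_class_def by blast
    have "\<not> 3 dvd t * u" using t(1) u by (simp add: prime_dvd_mult_iff)
    then show "f \<in> scale_class a b"
      unfolding scale_class_def by (intro image_eqI[of _ _ "t * u"]) (simp_all add: t(2) mult.assoc)
  qed
  have "coprime u (int n)" using assms by (simp only: coprime_n_iff not_False_eq_True)
  then obtain v where v: "[u * v = 1] (mod int n)"
    using cong_solve_coprime_int by blast
  have "coprime (u * v) (int n)" using cong_imp_coprime[OF cong_sym[OF v]] by simp
  then have v3: "\<not> 3 dvd v" unfolding coprime_n_iff using dvd_mult by blast
  have "[v * (u * x) = x] (mod int n)" for x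
    using cong_scalar_left[OF v, of x] by (simp add: mult_ac)
  then have "mrs_diff n (t * (v * (u * a))) (t * (v * (u * b))) = mrs_diff n (t * a) (t * b)" for t
    by (intro mrs_diff_cong cong_scalar_left)
  then have "scale_class (v * (u * a)) (v * (u * b)) = scale_class a b"
    by (simp add: scale_class_def)
  then show ?thesis using sub[OF assms, of a b] sub[OF v3, of "u * a" "u * b"] by blast
qed

lemma mrs_equiv_Image:
  assumes "distinct_diffs n a b"
  shows "mrs_equiv n `` {mrs_diff n a b} = scale_class a b"
proof (intro subset_antisym subsetI)
  fix f assume "f \<in> mrs_equiv n `` {mrs_diff n a b}"
  then obtain a' b' u where "distinct_diffs n a' b'" "\<not> 3 dvd u"
    "mrs_diff n a b = mrs_diff n a' b'" "f = mrs_diff n (u * a') (u * b')"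
    by (auto simp: mrs_equiv_iff)
  then show "f \<in> scale_class a b"
    using scale_class_eqI[OF assms] by (simp add: scale_class_def)
next
  fix f assume "f \<in> scale_class a b"
  then show "f \<in> mrs_equiv n `` {mrs_diff n a b}"
    using assms by (auto simp: scale_class_def mrs_equiv_iff)
qed

lemma mrs_classes_eq: "mrs_classes n = {scale_class a b | a b. distinct_diffs n a b}"
  unfolding mrs_classes_def quotient_def cubic_mrs_eq[OF n_pos]
  using mrs_equiv_Image by blast

text \<open>Both classes are the unit orbit of a common member, so the quotient is a
  partition.\<close>

lemma scale_class_disjoint:
  assumes "distinct_diffs n a b" "distinct_diffs n a' b'"
    and "scale_class a b \<inter> scale_class a' b' \<noteq> {}"
  shows "scale_class a b = scale_class a' b'"
proof -
  obtain u u' where u: "\<not> 3 dvd u" "\<not> 3 dvd u'"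
    "mrs_diff n (u * a) (u * b) = mrs_diff n (u' * a') (u' * b')"
    using assms(3) by (auto simp: scale_class_def)
  then have "scale_class (u * a) (u * b) = scale_class (u' * a') (u' * b')"
    using assms by (intro scale_class_eqI diff_scale) auto
  then show ?thesis using u by (simp add: scale_class_scale)
qed

text \<open>For \<open>i \<le> k\<close> the power \<open>3 ^ i\<close> divides \<open>n\<close>, so
  divisibility survives congruence modulo \<open>n\<close> as well as the change of
  ordering.\<close>

lemma diff_eq_dvd:
  assumes "distinct_diffs n a b" "distinct_diffs n a' b'" "mrs_diff n a b = mrs_diff n a' b'" "i \<le> k"
  shows "3 ^ i dvd a \<and> 3 ^ i dvd b \<longleftrightarrow> 3 ^ i dvd a' \<and> 3 ^ i dvd b'"
proof -
  obtain p q where pq: "(p, q) \<in> variants a b" "[a' = p] (mod int n)" "[b' = q] (mod int n)"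
    using assms(3) unfolding diff_eq_iff[OF assms(1,2)] by blast
  have "(3::int) ^ i dvd int n" using assms(4) by (simp add: int_n le_imp_power_dvd)
  then have "3 ^ i dvd a' \<longleftrightarrow> 3 ^ i dvd p" "3 ^ i dvd b' \<longleftrightarrow> 3 ^ i dvd q"
    using pq(2,3) by (meson cong_dvd_iff cong_dvd_modulus)+
  then show ?thesis using variants_dvd[OF pq(1)] by simp
qed

lemma diff_eq_has_level:
  assumes "distinct_diffs n a b" "distinct_diffs n a' b'" "mrs_diff n a b = mrs_diff n a' b'" "m < k"
  shows "has_level m a b \<longleftrightarrow> has_level m a' b'"
  using diff_eq_dvd[OF assms(1-3), of m] diff_eq_dvd[OF assms(1-3), of "Suc m"] assms(4)
  unfolding has_level_def by auto

lemma ex_level: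
  assumes "distinct_diffs n a b"
  shows "\<exists>m<k. has_level m a b"
proof -
  let ?P = "\<lambda>i. \<not> (3 ^ i dvd a \<and> 3 ^ i dvd b)"
  have "?P k" using assms by (simp add: distinct_diffs_def int_n cong_0_iff)
  moreover have "\<not> ?P 0" by simp
  ultimately obtain m where "m < k" "\<not> ?P m" "?P (Suc m)"
    using ex_least_nat_less[of ?P k] by auto
  then show ?thesis unfolding has_level_def by blast
qed

text \<open>The points \<open>{0, a, b}\<close> form an arithmetic progression, in some order.\<close>

definition arithmetic :: "int \<Rightarrow> int \<Rightarrow> bool" where
  "arithmetic a b \<longleftrightarrow> (\<exists>d. distinct_diffs n d (2 * d) \<and> mrs_diff n a b = mrs_diff n d (2 * d))"

text \<open>The alternatives say that \<open>a\<close>, \<open>b\<close> or \<open>0\<close> is the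
  midpoint of the other two points. An ordering with the midpoint in second place has differences
  \<open>d\<close> and \<open>2 * d\<close>.\<close>

lemma arithmeticI:
  assumes "distinct_diffs n a b"
    and "[b = 2 * a] (mod int n) \<or> [a = 2 * b] (mod int n) \<or> [a + b = 0] (mod int n)"
  shows "arithmetic a b"
proof -
  have *: "arithmetic a b" if "[q = 2 * p] (mod int n)" "(p, q) \<in> variants a b" for p q
  proof -
    have "distinct_diffs n p q" using that assms(1) variants_distinct_diffs by blast
    then have "distinct_diffs n p (2 * p)"
      using that(1) unfolding distinct_diffs_def by (metis cong_sym cong_trans)
    moreover have "mrs_diff n a b = mrs_diff n p (2 * p)"
      using mrs_diff_variants[OF that(2)] mrs_diff_cong[OF cong_refl that(1)] by simp
    ultimately show ?thesis by (auto simp: arithmetic_def)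
  qed
  from assms(2) show ?thesis
  proof (elim disjE)
    assume "[b = 2 * a] (mod int n)"
    then show ?thesis by (rule *) (simp add: variants_def)
  next
    assume "[a = 2 * b] (mod int n)"
    then show ?thesis by (rule *) (simp add: variants_def)
  next
    assume "[a + b = 0] (mod int n)"
    then have "[b - a = 2 * (- a)] (mod int n)" by (simp add: cong_iff_dvd_diff algebra_simps)
    then show ?thesis by (rule *) (simp add: variants_def)
  qed
qed

text \<open>
  The six variants are the permutations of three points: the identity gives \<open>u = v\<close>, the
  transpositions give \<open>u\<^sup>2 = v\<^sup>2\<close>, and the 3-cycles give \<open>u\<^sup>2 + u v + v\<^sup>2 = 0\<close> modulo \<open>3\<^bsup>k-m\<^esup>\<close>.
\<close>

lemma scale_eq_cases:
  assumes d: "distinct_diffs n a b" and level: "has_level m a b" and m: "m + 2 \<le> k"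
    and u: "\<not> 3 dvd u" and v: "\<not> 3 dvd v"
    and eq: "mrs_diff n (u * a) (u * b) = mrs_diff n (v * a) (v * b)"
  shows "3 ^ (k - m) dvd u - v \<or> 3 ^ (k - m) dvd u + v \<and> arithmetic a b"
proof -
  let ?N = "int n"
  have "m < k" using m by simp
  note cancel = has_level_cancel[OF level this, folded int_n]
  have mult: "?N dvd c * a" "?N dvd c * b" if "3 ^ (k - m) dvd c" for c
  proof -
    have "?N = 3 ^ (k - m) * 3 ^ m" using m by (simp add: int_n flip: power_add)
    then show "?N dvd c * a" "?N dvd c * b"
      using that level by (auto simp: has_level_def intro: mult_dvd_mono)
  qed
  have cop: "?N dvd x" if "?N dvd u * x" for x
    using that u coprime_n_iff by (simp add: coprime_commute coprime_dvd_mult_right_iff)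
  have nd: "\<not> ?N dvd a" "\<not> ?N dvd b" "\<not> ?N dvd a - b"
    using d by (auto simp: distinct_diffs_def cong_iff_dvd_diff)
  \<comment> \<open>As \<open>m + 2 \<le> k\<close>, the modulus \<open>3 ^ (k - m)\<close> left
    after cancelling is still divisible by 9.\<close>
  have three: False if "?N dvd (u\<^sup>2 + u * v + v\<^sup>2) * a" "?N dvd (u\<^sup>2 + u * v + v\<^sup>2) * b"
  proof -
    have "(3::int) ^ 2 dvd 3 ^ (k - m)" using m by (intro le_imp_power_dvd) simp
    then have "9 dvd u\<^sup>2 + u * v + v\<^sup>2" using cancel[OF that] by (simp add: dvd_trans)
    then show False using nine_dvd_cyclotomic u v by blast
  qed
  have two: "3 ^ (k - m) dvd u - v \<or> 3 ^ (k - m) dvd u + v"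
    if "?N dvd (u\<^sup>2 - v\<^sup>2) * a" "?N dvd (u\<^sup>2 - v\<^sup>2) * b"
    using three_power_dvd_diff_squares[OF cancel[OF that] u] .
  obtain p q where pq: "(p, q) \<in> variants (u * a) (u * b)"
    "[v * a = p] (mod ?N)" "[v * b = q] (mod ?N)"
    using eq unfolding diff_eq_iff[OF diff_scale[OF d u] diff_scale[OF d v]] by blast
  have p: "?N dvd v * a - p" and q: "?N dvd v * b - q"
    using pq by (simp_all add: cong_iff_dvd_diff)
  \<comment> \<open>The divisibilities below are integer combinations of the two given congruences;
    the coefficients are supplied as \<open>c\<close> and \<open>c'\<close>.\<close>
  have comb: "?N dvd x" if "x = c * (v * a - p) + c' * (v * b - q)" for x c c'
    unfolding that using p q by (intro dvd_add dvd_mult)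
  have comb2: "?N dvd x" if "?N dvd y" "?N dvd z" "x = y * c + z * c'" for x y z c c'
    using that by simp
  from pq(1) show ?thesis
  proof (cases rule: variants_cases)
    case 1
    have "?N dvd (u - v) * a" by (rule comb[of _ "-1" 0]) (simp add: 1 algebra_simps)
    moreover have "?N dvd (u - v) * b" by (rule comb[of _ 0 "-1"]) (simp add: 1 algebra_simps)
    ultimately show ?thesis using cancel by blast
  next
    case 2
    have "?N dvd (u\<^sup>2 - v\<^sup>2) * a"
      by (rule comb[of _ "-v" "-u"]) (simp add: 2 algebra_simps power2_eq_square)
    moreover have "?N dvd (u\<^sup>2 - v\<^sup>2) * b"
      by (rule comb[of _ "-u" "-v"]) (simp add: 2 algebra_simps power2_eq_square)
    ultimately consider "3 ^ (k - m) dvd u - v" | "3 ^ (k - m) dvd u + v" using two by blast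
    then show ?thesis
    proof cases
      case 1 then show ?thesis ..
    next
      case plus: 2
      \<comment> \<open>A transposition fixes one point. If \<open>u\<close> acts as
        \<open>- v\<close>, this point is the midpoint of the two swapped ones: here
        \<open>0\<close>, in the other two transposition cases \<open>b\<close> and
        \<open>a\<close>.\<close>
      have "?N dvd u * (a + b)"
        by (rule comb2[OF mult(1)[OF plus] p, of _ 1 "-1"]) (simp add: 2 algebra_simps)
      from cop[OF this] have "[a + b = 0] (mod ?N)" by (simp add: cong_0_iff)
      then show ?thesis using plus arithmeticI[OF d] by blast
    qed
  next
    case 3
    have "?N dvd (u\<^sup>2 - v\<^sup>2) * a"
      by (rule comb[of _ "u - v" 0]) (simp add: 3 algebra_simps power2_eq_square)
    moreover have "?N dvd (u\<^sup>2 - v\<^sup>2) * b"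
      by (rule comb[of _ "u" "- u - v"]) (simp add: 3 algebra_simps power2_eq_square)
    ultimately consider "3 ^ (k - m) dvd u - v" | "3 ^ (k - m) dvd u + v" using two by blast
    then show ?thesis
    proof cases
      case 1 then show ?thesis ..
    next
      case plus: 2
      have "?N dvd u * (a - 2 * b)"
        by (rule comb2[OF mult(2)[OF plus] q, of _ "-1" 1]) (simp add: 3 algebra_simps)
      from cop[OF this] have "[a = 2 * b] (mod ?N)" by (simp add: cong_iff_dvd_diff)
      then show ?thesis using plus arithmeticI[OF d] by blast
    qed
  next
    case 4
    have "?N dvd (u\<^sup>2 + u * v + v\<^sup>2) * a"
      by (rule comb[of _ v u]) (simp add: 4 algebra_simps power2_eq_square)
    moreover have "?N dvd (u\<^sup>2 + u * v + v\<^sup>2) * b"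
      by (rule comb[of _ "- u" "u + v"]) (simp add: 4 algebra_simps power2_eq_square)
    ultimately show ?thesis using three by blast
  next
    case 5
    have "?N dvd (u\<^sup>2 + u * v + v\<^sup>2) * a"
      by (rule comb[of _ "u + v" "- u"]) (simp add: 5 algebra_simps power2_eq_square)
    moreover have "?N dvd (u\<^sup>2 + u * v + v\<^sup>2) * b"
      by (rule comb[of _ u v]) (simp add: 5 algebra_simps power2_eq_square)
    ultimately show ?thesis using three by blast
  next
    case 6
    have "?N dvd (u\<^sup>2 - v\<^sup>2) * a"
      by (rule comb[of _ "- u - v" "u"]) (simp add: 6 algebra_simps power2_eq_square)
    moreover have "?N dvd (u\<^sup>2 - v\<^sup>2) * b"
      by (rule comb[of _ 0 "u - v"]) (simp add: 6 algebra_simps power2_eq_square)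
    ultimately consider "3 ^ (k - m) dvd u - v" | "3 ^ (k - m) dvd u + v" using two by blast
    then show ?thesis
    proof cases
      case 1 then show ?thesis ..
    next
      case plus: 2
      have "?N dvd u * (b - 2 * a)"
        by (rule comb2[OF mult(1)[OF plus] p, of _ "-1" 1]) (simp add: 6 algebra_simps)
      from cop[OF this] have "[b = 2 * a] (mod ?N)" by (simp add: cong_iff_dvd_diff)
      then show ?thesis using plus arithmeticI[OF d] by blast
    qed
  qed
qed

end

section \<open>Sizes and number of the classes\<close>

lemma card_not_three_dvd: "card {u \<in> {0..<3 ^ Suc r}. \<not> 3 dvd (u::int)} = 2 * 3 ^ r"
proof -
  have "{u \<in> {0..<3 ^ Suc r}. \<not> 3 dvd (u::int)} =
      (\<lambda>s. 3 * s + 1) ` {0..<3 ^ r} \<union> (\<lambda>s. 3 * s + 2) ` {0..<3 ^ r}"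
  proof (intro subset_antisym subsetI)
    fix u :: int assume u: "u \<in> {u \<in> {0..<3 ^ Suc r}. \<not> 3 dvd u}"
    then have "u div 3 \<in> {0..<3 ^ r}" by (simp; presburger)
    moreover have "u = 3 * (u div 3) + 1 \<or> u = 3 * (u div 3) + 2" using u by (simp; presburger)
    ultimately show "u \<in> (\<lambda>s. 3 * s + 1) ` {0..<3 ^ r} \<union> (\<lambda>s. 3 * s + 2) ` {0..<3 ^ r}" by blast
  qed (auto; presburger)
  moreover have "(\<lambda>s. 3 * s + 1) ` {0..<3 ^ r} \<inter> (\<lambda>s. 3 * s + 2) ` {0..<3 ^ r} = ({} :: int set)"
    by (auto; presburger)
  ultimately show ?thesis
    by (simp add: card_Un_disjoint card_image inj_on_def nat_power_eq)
qed

text \<open>These residues represent the units modulo \<open>3 ^ Suc r\<close> up to sign, since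
  exactly one of \<open>u\<close> and \<open>- u\<close> is 1 modulo 3.\<close>

lemma card_cong_1_mod_3: "card {u \<in> {0..<3 ^ Suc r}. u mod 3 = (1::int)} = 3 ^ r"
proof -
  have "{u \<in> {0..<3 ^ Suc r}. u mod 3 = (1::int)} = (\<lambda>s. 3 * s + 1) ` {0..<3 ^ r}"
  proof (intro subset_antisym subsetI)
    fix u :: int assume u: "u \<in> {u \<in> {0..<3 ^ Suc r}. u mod 3 = 1}"
    then have "u div 3 \<in> {0..<3 ^ r}" by (simp; presburger)
    moreover have "u = 3 * (u div 3) + 1" using u by (simp; presburger)
    ultimately show "u \<in> (\<lambda>s. 3 * s + 1) ` {0..<3 ^ r}" by blast
  qed (auto; presburger)
  then show ?thesis by (simp add: card_image inj_on_def nat_power_eq)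
qed

text \<open>As integer pairs the six variants differ, the integers having no 3-torsion. Their
  distinctness modulo \<open>n\<close> is the separate matter of
  \<open>variants_inj_mod\<close>.\<close>

lemma card_variants:
  assumes "distinct_diffs n a b"
  shows "card (variants a b) = 6"
proof -
  have "a \<noteq> 0" "b \<noteq> 0" "a \<noteq> b" using assms by (auto simp: distinct_diffs_def)
  then show ?thesis unfolding variants_def by (subst card_insert_disjoint, simp, force)+ simp
qed

lemma card_distinct_pairs:
  "card {(x, y). x \<in> {1..<int M} \<and> y \<in> {1..<int M} \<and> x \<noteq> y} = (M - 1) * (M - 2)"
proof -
  have "{(x, y). x \<in> {1..<int M} \<and> y \<in> {1..<int M} \<and> x \<noteq> y}
      = (SIGMA x:{1..<int M}. {1..<int M} - {x})" by auto
  moreover have "card ({1..<int M} - {x}) = M - 2" if "x \<in> {1..<int M}" for x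
    using that by simp
  moreover have "card {1..<int M} = M - 1" by simp
  ultimately show ?thesis by (simp only: card_SigmaI finite_atLeastLessThan_int finite_Diff
    ball_simps sum_constant cong: sum.cong) simp
qed

lemma odd_three_power_neq: "(3::nat) ^ i \<noteq> 2 * 3 ^ j"
proof
  assume "(3::nat) ^ i = 2 * 3 ^ j"
  then have "even ((3::nat) ^ i)" by simp
  then show False by simp
qed

lemma has_level_unique:
  assumes "has_level m a b" "has_level m' a b"
  shows "m = m'"
proof -
  have "m' \<le> m" if "has_level m a b" "has_level m' a b" for m m'
  proof (rule ccontr)
    assume "\<not> m' \<le> m"
    then have "(3::int) ^ Suc m dvd 3 ^ m'" by (intro le_imp_power_dvd) simp
    then show False using that dvd_trans unfolding has_level_def by blast
  qed
  then show ?thesis using assms by (simp add: le_antisym)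
qed

context three_power
begin

section \<open>Class sizes on a fixed level\<close>

lemma distinct_diffs_double: "distinct_diffs n d (2 * d) \<longleftrightarrow> \<not> 3 ^ k dvd d"
proof -
  have "coprime (3 ^ k) (2::int)" by (rule coprime_three_power) simp
  then have "3 ^ k dvd 2 * d \<longleftrightarrow> 3 ^ k dvd d" by (simp add: coprime_dvd_mult_right_iff)
  then show ?thesis by (auto simp: distinct_diffs_def cong_iff_dvd_diff int_n)
qed

lemma distinct_diffs_three_power: "m < k \<Longrightarrow> distinct_diffs n (3 ^ m) (2 * 3 ^ m)"
  unfolding distinct_diffs_double by (rule zdvd_not_zless) simp_all

lemma has_level_double: "has_level m d (2 * d) \<longleftrightarrow> 3 ^ m dvd d \<and> \<not> 3 ^ Suc m dvd d"
  by (auto simp: has_level_def)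

lemma has_level_three_power: "has_level m (3 ^ m) (2 * 3 ^ m)"
  unfolding has_level_double by simp

text \<open>Both differences contain \<open>3 ^ m\<close>, so changing \<open>u\<close> by a
  multiple of \<open>3 ^ (k - m)\<close> changes the scaled differences by multiples of
  \<open>n\<close>.\<close>

lemma scale_cong:
  assumes "has_level m a b" "m \<le> k" "[u = v] (mod 3 ^ (k - m))"
  shows "mrs_diff n (u * a) (u * b) = mrs_diff n (v * a) (v * b)"
proof -
  have "int n = 3 ^ (k - m) * 3 ^ m" using assms(2) by (simp add: int_n flip: power_add)
  then have "int n dvd (u - v) * a" "int n dvd (u - v) * b"
    using assms(1,3) by (auto simp: has_level_def cong_iff_dvd_diff intro: mult_dvd_mono)
  then show ?thesis by (intro mrs_diff_cong) (simp_all add: cong_iff_dvd_diff left_diff_distrib)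
qed

lemma mod_three_power_residue:
  assumes "m < k"
  shows "u mod 3 ^ (k - m) \<in> {0..<3 ^ (k - m)}" "(u mod 3 ^ (k - m)) mod 3 = u mod (3::int)"
proof -
  have "3 dvd (3::int) ^ (k - m)" using assms by (simp add: dvd_power)
  then show "(u mod 3 ^ (k - m)) mod 3 = u mod (3::int)" by (rule mod_mod_cancel)
qed simp

lemma eq_if_three_power_dvd:
  assumes "u \<in> {0..<3 ^ r}" "v \<in> {0..<3 ^ r}" "3 ^ r dvd u - (v::int)"
  shows "u = v"
  using assms by (metis atLeastLessThan_iff mod_eq_dvd_iff mod_pos_pos_trivial)

text \<open>For \<open>k = Suc m\<close> the differences divided by \<open>3 ^ m\<close> are 1 and 2
  modulo 3 in some order, which is a progression.\<close>

lemma nonarithmetic_level: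
  assumes d: "distinct_diffs n a b" and level: "has_level m a b" and m: "m < k"
    and "\<not> arithmetic a b"
  shows "m + 2 \<le> k"
proof (rule ccontr)
  assume "\<not> m + 2 \<le> k"
  with m have k': "k = Suc m" by simp
  obtain a' b' where ab: "a = 3 ^ m * a'" "b = 3 ^ m * b'"
    using level by (auto simp: has_level_def elim!: dvdE)
  have *: "int n dvd 3 ^ m * c \<longleftrightarrow> 3 dvd c" for c
    by (simp add: int_n k')
  have "\<not> 3 dvd a'" "\<not> 3 dvd b'" "\<not> 3 dvd a' - b'"
    using d by (auto simp: distinct_diffs_def cong_iff_dvd_diff ab * simp flip: right_diff_distrib)
  then have "3 dvd b' - 2 * a'" by presburger
  then have "int n dvd 3 ^ m * (b' - 2 * a')" by (simp only: *)
  then have "[b = 2 * a] (mod int n)"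
    by (simp add: ab cong_iff_dvd_diff algebra_simps)
  then show False using arithmeticI[OF d] assms(4) by blast
qed

text \<open>By \<open>scale_eq_cases\<close> the units modulo \<open>3 ^ (k - m)\<close> act freely,
  so the class has as many members as there are units.\<close>

lemma card_nonarithmetic_class:
  assumes d: "distinct_diffs n a b" and level: "has_level m a b" and m: "m < k"
    and nonar: "\<not> arithmetic a b"
  shows "card (scale_class a b) = 2 * 3 ^ (k - m - 1)"
proof -
  let ?U = "{u \<in> {0..<3 ^ (k - m)}. \<not> 3 dvd (u::int)}"
  let ?f = "\<lambda>u. mrs_diff n (u * a) (u * b)"
  have m2: "m + 2 \<le> k" using nonarithmetic_level[OF assms] .
  have "scale_class a b \<subseteq> ?f ` ?U"
  proof
    fix f assume "f \<in> scale_class a b"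
    then obtain u where u: "\<not> 3 dvd u" "f = ?f u" by (auto simp: scale_class_def)
    have "f = ?f (u mod 3 ^ (k - m))"
      unfolding u(2) using m by (intro scale_cong[OF level]) (auto simp: cong_def)
    moreover have "u mod 3 ^ (k - m) \<in> ?U"
      using mod_three_power_residue[OF m, of u] u(1) by (simp add: dvd_eq_mod_eq_0)
    ultimately show "f \<in> ?f ` ?U" by blast
  qed
  moreover have "?f ` ?U \<subseteq> scale_class a b" by (auto simp: scale_class_def)
  ultimately have "scale_class a b = ?f ` ?U" by blast
  moreover have "inj_on ?f ?U"
  proof (rule inj_onI)
    fix u v assume uv: "u \<in> ?U" "v \<in> ?U" "?f u = ?f v"
    then have "3 ^ (k - m) dvd u - v"
      using scale_eq_cases[OF d level m2, of u v] nonar by simp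
    then show "u = v" using uv eq_if_three_power_dvd by blast
  qed
  moreover have "k - m = Suc (k - m - 1)" using m by simp
  ultimately show ?thesis using card_not_three_dvd[of "k - m - 1"] by (simp add: card_image)
qed

text \<open>Reversing a progression realises \<open>u = -1\<close>, and no further unit fixes it, so
  the class has one member for each unit up to sign.\<close>

lemma card_arithmetic_class:
  assumes m: "m < k"
  shows "card (scale_class (3 ^ m) (2 * 3 ^ m)) = 3 ^ (k - m - 1)"
proof -
  let ?U = "{u \<in> {0..<3 ^ (k - m)}. u mod 3 = (1::int)}"
  let ?f = "\<lambda>u. mrs_diff n (u * 3 ^ m) (u * (2 * 3 ^ m))"
  note d = distinct_diffs_three_power[OF m] and level = has_level_three_power[of m]
  have neg: "?f (- u) = ?f u" for u
    by (rule mrs_diff_variants) (simp add: variants_def)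
  have red: "?f u \<in> ?f ` ?U" if "u mod 3 = 1" for u
  proof -
    have "?f u = ?f (u mod 3 ^ (k - m))"
      using m by (intro scale_cong[OF level]) (auto simp: cong_def)
    moreover have "u mod 3 ^ (k - m) \<in> ?U"
      using mod_three_power_residue[OF m, of u] that by simp
    ultimately show ?thesis by blast
  qed
  have "scale_class (3 ^ m) (2 * 3 ^ m) \<subseteq> ?f ` ?U"
  proof
    fix f assume "f \<in> scale_class (3 ^ m) (2 * 3 ^ m)"
    then obtain u where u: "\<not> 3 dvd u" "f = ?f u" by (auto simp: scale_class_def)
    have "u mod 3 = 1 \<or> (- u) mod 3 = 1" using u(1) by presburger
    then show "f \<in> ?f ` ?U" using red[of u] red[of "- u"] neg[of u] u(2) by metis
  qed
  moreover have "?f ` ?U \<subseteq> scale_class (3 ^ m) (2 * 3 ^ m)"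
    by (auto simp: scale_class_def)
  ultimately have "scale_class (3 ^ m) (2 * 3 ^ m) = ?f ` ?U" by blast
  moreover have "inj_on ?f ?U"
  proof (rule inj_onI)
    fix u v assume uv: "u \<in> ?U" "v \<in> ?U" "?f u = ?f v"
    then have nd: "\<not> 3 dvd u" "\<not> 3 dvd v" "3 dvd u - v" "\<not> 3 dvd u + v"
      by (simp; presburger)+
    have "3 ^ (k - m) dvd u - v"
    proof (cases "m + 2 \<le> k")
      case True
      have "3 dvd (3::int) ^ (k - m)" using m by (simp add: dvd_power)
      then have "\<not> 3 ^ (k - m) dvd u + v" using nd(4) dvd_trans by blast
      then show ?thesis using scale_eq_cases[OF d level True nd(1,2) uv(3)] by blast
    next
      \<comment> \<open>On the last level the modulus is 3, and both residues are 1 already.\<close>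
      case False
      then have "k - m = 1" using m by simp
      then show ?thesis using nd by simp
    qed
    then show "u = v" using uv eq_if_three_power_dvd by blast
  qed
  moreover have "k - m = Suc (k - m - 1)" using m by simp
  ultimately show ?thesis using card_cong_1_mod_3[of "k - m - 1"] by (simp add: card_image)
qed

text \<open>The common difference has the same level, so it is a unit times \<open>3 ^ m\<close>;
  each level thus has just one class of progressions.\<close>

lemma arithmetic_class_eq:
  assumes d: "distinct_diffs n a b" and level: "has_level m a b" and m: "m < k"
    and ar: "arithmetic a b"
  shows "scale_class a b = scale_class (3 ^ m) (2 * 3 ^ m)"
proof -
  obtain c where c: "distinct_diffs n c (2 * c)" "mrs_diff n a b = mrs_diff n c (2 * c)"
    using ar by (auto simp: arithmetic_def)
  have "has_level m c (2 * c)" using diff_eq_has_level[OF d c m] level by simp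
  then obtain e where e: "c = e * 3 ^ m" "\<not> 3 dvd e"
    unfolding has_level_double by (auto elim!: dvdE)
  have "scale_class a b = scale_class c (2 * c)" by (rule scale_class_eqI[OF d c])
  also have "\<dots> = scale_class (e * 3 ^ m) (e * (2 * 3 ^ m))" by (simp add: e(1) mult_ac)
  also have "\<dots> = scale_class (3 ^ m) (2 * 3 ^ m)" by (rule scale_class_scale[OF e(2)])
  finally show ?thesis .
qed

section \<open>Counting pairs, functions and classes on each level\<close>

definition level_pairs :: "nat \<Rightarrow> (int \<times> int) set" where
  "level_pairs m = {(a, b). a \<in> {1..<3 ^ k} \<and> b \<in> {1..<3 ^ k} \<and> a \<noteq> b \<and> has_level m a b}"

definition level_classes :: "nat \<Rightarrow> anf set set" where
  "level_classes m = {scale_class a b | a b. distinct_diffs n a b \<and> has_level m a b}"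

text \<open>Pairs divisible by \<open>3 ^ Suc m\<close> are removed from those divisible by
  \<open>3 ^ m\<close>. The additive form avoids a truncated subtraction of the two counts.\<close>

lemma card_level_pairs:
  assumes "m < k"
  shows "card (level_pairs m) + (3 ^ (k - m - 1) - 1) * (3 ^ (k - m - 1) - 2) =
    (3 ^ (k - m) - 1) * (3 ^ (k - m) - 2)"
proof -
  define Q where "Q i = {(a, b). a \<in> {1..<3 ^ k} \<and> b \<in> {1..<3 ^ k} \<and> a \<noteq> b \<and>
    3 ^ i dvd a \<and> 3 ^ i dvd (b::int)}" for i
  have fin: "finite (Q i)" for i
    by (rule finite_subset[of _ "{1..<3 ^ k} \<times> {1..<3 ^ k}"]) (auto simp: Q_def)
  have card_Q: "card (Q i) = (3 ^ (k - i) - 1) * (3 ^ (k - i) - 2)" if "i \<le> k" for i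
  proof -
    let ?P = "{(x, y). x \<in> {1..<int (3 ^ (k - i))} \<and> y \<in> {1..<int (3 ^ (k - i))} \<and> x \<noteq> y}"
    have k': "(3::int) ^ k = 3 ^ i * 3 ^ (k - i)" using that by (simp flip: power_add)
    have *: "3 ^ i * x \<in> {1..<3 ^ k} \<longleftrightarrow> x \<in> {1..<int (3 ^ (k - i))}" for x
      by (simp add: k' int_one_le_iff_zero_less zero_less_mult_iff)
    have "Q i = (\<lambda>(x, y). (3 ^ i * x, 3 ^ i * y)) ` ?P"
      using * by (auto simp: Q_def elim!: dvdE simp del: atLeastLessThan_iff)
    moreover have "inj_on (\<lambda>(x, y). (3 ^ i * x, 3 ^ i * y)) (?P :: (int \<times> int) set)"
      by (auto simp: inj_on_def)
    ultimately have "card (Q i) = card ?P" by (simp only: card_image)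
    then show ?thesis by (simp only: card_distinct_pairs)
  qed
  have "level_pairs m = Q m - Q (Suc m)"
    by (auto simp: level_pairs_def Q_def has_level_def)
  moreover have "Q (Suc m) \<subseteq> Q m"
    by (auto simp: Q_def intro: dvd_mult_right)
  ultimately have "card (level_pairs m) + card (Q (Suc m)) = card (Q m)"
    using fin by (simp add: card_Diff_subset card_mono)
  then show ?thesis using card_Q[of m] card_Q[of "Suc m"] assms by simp
qed

lemma level_pairs_iff:
  "(a, b) \<in> level_pairs m \<longleftrightarrow> a \<in> {0..<3 ^ k} \<and> b \<in> {0..<3 ^ k} \<and>
     distinct_diffs n a b \<and> has_level m a b"
proof -
  have "distinct_diffs n a b \<longleftrightarrow> a \<noteq> 0 \<and> b \<noteq> 0 \<and> a \<noteq> b"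
    if "a \<in> {0..<3 ^ k}" "b \<in> {0..<3 ^ k}"
    using that by (simp add: distinct_diffs_def cong_def int_n)
  moreover have "x \<in> {1..<3 ^ k} \<longleftrightarrow> x \<in> {0..<3 ^ k} \<and> x \<noteq> 0" for x :: int by auto
  ultimately show ?thesis unfolding level_pairs_def by blast
qed

lemma reduce_mod:
  assumes "distinct_diffs n a b" "has_level m a b" "m < k"
  shows "(a mod 3 ^ k, b mod 3 ^ k) \<in> level_pairs m"
    and "mrs_diff n (a mod 3 ^ k) (b mod 3 ^ k) = mrs_diff n a b"
proof -
  show eq: "mrs_diff n (a mod 3 ^ k) (b mod 3 ^ k) = mrs_diff n a b"
    by (rule mrs_diff_cong) (simp_all add: cong_def int_n)
  have d: "distinct_diffs n (a mod 3 ^ k) (b mod 3 ^ k)"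
    using assms(1) by (simp add: distinct_diffs_def cong_def int_n)
  show "(a mod 3 ^ k, b mod 3 ^ k) \<in> level_pairs m"
    using diff_eq_has_level[OF assms(1) d eq[symmetric] assms(3)] assms(2) d
    by (simp add: level_pairs_iff)
qed

lemma mrs_diff_image_level_pairs:
  assumes "m < k"
  shows "(\<lambda>(a, b). mrs_diff n a b) ` level_pairs m = \<Union> (level_classes m)"
proof (intro subset_antisym subsetI)
  fix f assume "f \<in> (\<lambda>(a, b). mrs_diff n a b) ` level_pairs m"
  then show "f \<in> \<Union> (level_classes m)"
    using scale_class_self by (fastforce simp: level_pairs_iff level_classes_def)
next
  fix f assume "f \<in> \<Union> (level_classes m)"
  then obtain a b u where ab: "distinct_diffs n a b" "has_level m a b" "\<not> 3 dvd u"
    and f: "f = mrs_diff n (u * a) (u * b)"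
    by (auto simp: level_classes_def scale_class_def)
  note r = reduce_mod[OF diff_scale[OF ab(1,3)] _ assms]
  have "has_level m (u * a) (u * b)" using ab by (simp add: has_level_scale)
  from r(1)[OF this] r(2)[OF this] show "f \<in> (\<lambda>(a, b). mrs_diff n a b) ` level_pairs m"
    unfolding f by (metis (no_types, lifting) case_prod_conv image_eqI)
qed

text \<open>A transposition with the same residues would make two points congruent. A 3-cycle would
  make \<open>3 * a\<close> and \<open>3 * b\<close> vanish modulo \<open>3 ^ k\<close>, contrary to
  \<open>m + 2 \<le> k\<close>.\<close>

lemma variants_inj_mod:
  assumes d: "distinct_diffs n a b" and level: "has_level m a b" and m: "m + 2 \<le> k"
    and pq: "(p, q) \<in> variants a b" and dvd: "3 ^ k dvd a - p" "3 ^ k dvd b - q"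
  shows "p = a \<and> q = b"
proof -
  have nd: "\<not> 3 ^ k dvd a" "\<not> 3 ^ k dvd b" "\<not> 3 ^ k dvd a - b"
    using d by (auto simp: distinct_diffs_def cong_iff_dvd_diff int_n)
  have three: "\<not> (3 ^ k dvd 3 * a \<and> 3 ^ k dvd 3 * b)"
  proof
    assume "3 ^ k dvd 3 * a \<and> 3 ^ k dvd 3 * b"
    then have "(3::int) ^ (k - m) dvd 3" using has_level_cancel[OF level, of k 3] m by simp
    moreover have "(3::int) ^ 2 dvd 3 ^ (k - m)" using m by (intro le_imp_power_dvd) simp
    ultimately have "(3::int) ^ 2 dvd 3" by (rule dvd_trans[rotated])
    then show False by simp
  qed
  from pq show ?thesis
  proof (cases rule: variants_cases)
    case 4
    have "3 ^ k dvd (a - p) + (b - q)" "3 ^ k dvd 2 * (b - q) - (a - p)"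
      by (intro dvd_add dvd_diff dvd_mult dvd)+
    then show ?thesis using three 4 by (simp add: algebra_simps)
  next
    case 5
    have "3 ^ k dvd 2 * (a - p) - (b - q)" "3 ^ k dvd (a - p) + (b - q)"
      by (intro dvd_add dvd_diff dvd_mult dvd)+
    then show ?thesis using three 5 by (simp add: algebra_simps)
  qed (use nd dvd in auto)
qed

text \<open>The fibre over a function consists of the reduced variants of one pair, and these are
  six distinct pairs.\<close>

lemma card_level_functions:
  assumes m: "m + 2 \<le> k"
  shows "card (level_pairs m) = 6 * card (\<Union> (level_classes m))"
proof -
  let ?g = "\<lambda>(a, b). mrs_diff n a b"
  let ?r = "\<lambda>(a, b). (a mod 3 ^ k, b mod (3::int) ^ k)"
  have "m < k" using m by simp
  have fin: "finite (level_pairs m)"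
    by (rule finite_subset[of _ "{1..<3 ^ k} \<times> {1..<3 ^ k}"]) (auto simp: level_pairs_def)
  have fibre: "card {x \<in> level_pairs m. ?g x = f} = 6" if mem: "f \<in> ?g ` level_pairs m" for f
  proof -
    obtain a b where ab: "(a, b) \<in> level_pairs m" and f: "f = mrs_diff n a b" using mem by auto
    have d: "distinct_diffs n a b" and level: "has_level m a b"
      using ab by (auto simp: level_pairs_iff)
    have var: "distinct_diffs n p q \<and> has_level m p q \<and> mrs_diff n p q = f"
      if "(p, q) \<in> variants a b" for p q
    proof -
      have d': "distinct_diffs n p q" using variants_distinct_diffs[OF that d] .
      moreover have "mrs_diff n a b = mrs_diff n p q" by (rule mrs_diff_variants[OF that])
      ultimately show ?thesis
        using diff_eq_has_level[OF d d' _ \<open>m < k\<close>] level f by simp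
    qed
    have "{x \<in> level_pairs m. ?g x = f} = ?r ` variants a b"
    proof (intro subset_antisym subsetI)
      fix x assume "x \<in> {x \<in> level_pairs m. ?g x = f}"
      then obtain a' b' where x: "x = (a', b')" "(a', b') \<in> level_pairs m" "mrs_diff n a b = mrs_diff n a' b'"
        using f by (cases x) auto
      then have d': "distinct_diffs n a' b'" and lt: "a' \<in> {0..<3 ^ k}" "b' \<in> {0..<3 ^ k}"
        unfolding level_pairs_iff by blast+
      obtain p q where pq: "(p, q) \<in> variants a b" "[a' = p] (mod int n)" "[b' = q] (mod int n)"
        using x(3) unfolding diff_eq_iff[OF d d'] by blast
      then have "x = ?r (p, q)" using x(1) lt by (simp add: cong_def int_n)
      then show "x \<in> ?r ` variants a b" using pq(1) by (rule image_eqI)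
    next
      fix x assume "x \<in> ?r ` variants a b"
      then obtain p q where pq: "(p, q) \<in> variants a b" "x = (p mod 3 ^ k, q mod 3 ^ k)" by auto
      then show "x \<in> {x \<in> level_pairs m. ?g x = f}"
        using reduce_mod[of p q m] var[OF pq(1)] \<open>m < k\<close> by simp
    qed
    moreover have "inj_on ?r (variants a b)"
    proof (rule inj_onI)
      fix x y assume xy: "x \<in> variants a b" "y \<in> variants a b" "?r x = ?r y"
      obtain p q p' q' where x: "x = (p, q)" and y: "y = (p', q')" by fastforce
      have "(p', q') \<in> variants p q" using xy variants_trans[of p q a b] by (simp add: x y)
      moreover have "3 ^ k dvd p - p'" "3 ^ k dvd q - q'"
        using xy(3) by (simp_all add: x y mod_eq_dvd_iff)
      ultimately have "p' = p \<and> q' = q"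
        using var[of p q] xy(1) variants_inj_mod[of p q m p' q'] m unfolding x by blast
      then show "x = y" by (simp add: x y)
    qed
    ultimately show ?thesis using card_variants[OF d] by (simp add: card_image)
  qed
  have "card (level_pairs m) = (\<Sum>f\<in>?g ` level_pairs m. card {x \<in> level_pairs m. ?g x = f})"
    using sum.image_gen[OF fin, of "\<lambda>_. 1::nat" ?g] by simp
  also have "\<dots> = 6 * card (?g ` level_pairs m)" using fibre by simp
  finally show ?thesis by (simp only: mrs_diff_image_level_pairs[OF \<open>m < k\<close>])
qed

lemma level_class_cases:
  assumes "C \<in> level_classes m" "m < k"
  shows "C = scale_class (3 ^ m) (2 * 3 ^ m) \<or> m + 2 \<le> k \<and> card C = 2 * 3 ^ (k - m - 1)"
  using assms arithmetic_class_eq nonarithmetic_level card_nonarithmetic_class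
  unfolding level_classes_def by blast

lemma arithmetic_class_in: "m < k \<Longrightarrow> scale_class (3 ^ m) (2 * 3 ^ m) \<in> level_classes m"
  using distinct_diffs_three_power has_level_three_power unfolding level_classes_def by blast

lemma finite_level_classes: 
  assumes "m < k"
  shows "finite (level_classes m)" 
proof (rule finite_UnionD)
  have "finite (level_pairs m)"
    by (rule finite_subset[of _ "{1..<3 ^ k} \<times> {1..<3 ^ k}"]) (auto simp: level_pairs_def)
  then show "finite (\<Union> (level_classes m))"
    by (simp flip: mrs_diff_image_level_pairs[OF assms])
qed

text \<open>With \<open>t = 3 ^ (k - m - 2)\<close>, the functions of level \<open>m\<close> form
  one class of size \<open>3 * t\<close> and \<open>c\<close> classes of size \<open>6 * t\<close>.
  Comparing with the count of pairs determines \<open>c\<close>.\<close>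

lemma card_level_classes:
  assumes m: "m + 2 \<le> k"
  shows "card (level_classes m - {scale_class (3 ^ m) (2 * 3 ^ m)}) = 2 * 3 ^ (k - m - 2) - 1"
proof -
  let ?C = "scale_class (3 ^ m) (2 * 3 ^ m)" and ?L = "level_classes m"
  define t :: nat where "t = 3 ^ (k - m - 2)"
  have mk: "m < k" using m by simp
  have "k - m - 1 = Suc (k - m - 2)" "k - m = Suc (Suc (k - m - 2))" using m by auto
  then have t: "3 ^ (k - m - 1) = 3 * t" "3 ^ (k - m) = 9 * t" by (simp_all add: t_def)
  have t1: "t \<ge> 1" by (simp add: t_def)
  note fin = finite_level_classes[OF mk]
  have "pairwise disjnt ?L"
    using scale_class_disjoint unfolding pairwise_def disjnt_def level_classes_def by blast
  moreover have "finite C" if "C \<in> ?L" for C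
  proof -
    \<comment> \<open>Infinite sets have \<open>card\<close> zero, so a nonzero value proves
      finiteness.\<close>
    have "card C \<noteq> 0" using level_class_cases[OF that mk] card_arithmetic_class[OF mk] by auto
    then show ?thesis by (metis card.infinite)
  qed
  ultimately have "card (\<Union> ?L) = (\<Sum>C\<in>?L. card C)" by (simp add: card_Union_disjoint)
  also have "\<dots> = card ?C + (\<Sum>C\<in>?L - {?C}. card C)"
    using fin arithmetic_class_in[OF mk] by (rule sum.remove)
  also have "(\<Sum>C\<in>?L - {?C}. card C) = (\<Sum>C\<in>?L - {?C}. 2 * (3 * t))"
    using level_class_cases[OF _ mk] t by (intro sum.cong) auto
  finally have U: "card (\<Union> ?L) = 3 * t + card (?L - {?C}) * (6 * t)"
    unfolding card_arithmetic_class[OF mk] t by simp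
  define c where "c = card (?L - {?C})"
  have "6 * (3 * t + c * (6 * t)) + (3 * t - 1) * (3 * t - 2) = (9 * t - 1) * (9 * t - 2)"
    using card_level_pairs[OF mk] card_level_functions[OF m] by (simp only: U t c_def)
  \<comment> \<open>Writing \<open>t\<close> as a successor removes the truncated subtractions from
    the equation.\<close>
  moreover obtain s where s: "t = Suc s" using t1 by (cases t) auto
  ultimately have "Suc s * c = Suc s * (2 * s + 1)" by (simp add: algebra_simps)
  then have "c = 2 * t - 1" unfolding s mult_cancel1 by simp
  then show ?thesis unfolding c_def t_def by simp
qed

section \<open>Assembling the levels and sorting the classes by size\<close>

lemma mrs_classes_Union: "mrs_classes n = (\<Union>m<k. level_classes m)"
proof (intro subset_antisym subsetI)
  fix C assume "C \<in> mrs_classes n"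
  then obtain a b where ab: "distinct_diffs n a b" "C = scale_class a b"
    unfolding mrs_classes_eq by blast
  from ex_level[OF ab(1)] obtain m where "m < k" "has_level m a b" by blast
  then show "C \<in> (\<Union>m<k. level_classes m)"
    using ab by (auto simp: level_classes_def)
qed (auto simp: mrs_classes_eq level_classes_def)

lemma level_classes_disjoint:
  assumes "m < k" "m' < k" "C \<in> level_classes m" "C \<in> level_classes m'"
  shows "m = m'"
proof -
  obtain a b a' b' where ab: "distinct_diffs n a b" "has_level m a b" "C = scale_class a b"
    and ab': "distinct_diffs n a' b'" "has_level m' a' b'" "C = scale_class a' b'"
    using assms(3,4) by (auto simp: level_classes_def)
  have "mrs_diff n a b \<in> scale_class a' b'" using scale_class_self ab(3) ab'(3) by metis
  then obtain u where u: "\<not> 3 dvd u" "mrs_diff n a b = mrs_diff n (u * a') (u * b')"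
    by (auto simp: scale_class_def)
  then have "has_level m' a b"
    using diff_eq_has_level[OF ab(1) diff_scale[OF ab'(1) u(1)] u(2) assms(2)] ab'(2)
    by (simp add: has_level_scale)
  then show ?thesis using ab(2) has_level_unique by blast
qed

lemma mrs_class_cases:
  assumes "C \<in> mrs_classes n"
  obtains m where "m < k" "C = scale_class (3 ^ m) (2 * 3 ^ m)"
  | m where "m + 2 \<le> k" "C \<in> level_classes m - {scale_class (3 ^ m) (2 * 3 ^ m)}"
      "card C = 2 * 3 ^ (k - m - 1)"
proof -
  obtain m where m: "m < k" "C \<in> level_classes m" using assms unfolding mrs_classes_Union by blast
  show thesis
  proof (cases "C = scale_class (3 ^ m) (2 * 3 ^ m)")
    case True
    then show thesis using that(1)[of m] m by blast
  next
    case False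
    then show thesis using that(2)[of m] level_class_cases[OF m(2,1)] m by blast
  qed
qed

text \<open>All other classes have even size, and the size of a progression class determines its
  level.\<close>

lemma classes_card_three_power:
  assumes "j \<le> k - 1"
  shows "C \<in> mrs_classes n \<and> card C = 3 ^ j \<longleftrightarrow>
    C = scale_class (3 ^ (k - j - 1)) (2 * 3 ^ (k - j - 1))"
proof
  assume C: "C \<in> mrs_classes n \<and> card C = 3 ^ j"
  then have "C \<in> mrs_classes n" by blast
  then show "C = scale_class (3 ^ (k - j - 1)) (2 * 3 ^ (k - j - 1))"
  proof (cases rule: mrs_class_cases)
    case (1 m)
    then have "3 ^ (k - m - 1) = (3::nat) ^ j" using C card_arithmetic_class[of m] by simp
    then have "k - m - 1 = j" by simp
    then have "m = k - j - 1" using 1(1) by simp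
    then show ?thesis using 1 by simp
  next
    case (2 m)
    then show ?thesis using C odd_three_power_neq[of j "k - m - 1"] by simp
  qed
next
  have "k - j - 1 < k" "k - (k - j - 1) - 1 = j" using assms k by simp_all
  then show "C \<in> mrs_classes n \<and> card C = 3 ^ j"
    if "C = scale_class (3 ^ (k - j - 1)) (2 * 3 ^ (k - j - 1))"
    unfolding that mrs_classes_Union using arithmetic_class_in card_arithmetic_class[of "k - j - 1"] by auto
qed

text \<open>Classes of even size occur only for \<open>m + 2 \<le> k\<close>, so their exponent
  \<open>k - m - 1\<close> is at least 1. The empty case \<open>j = 0\<close> is the absence of
  classes of size 2.\<close>

lemma classes_card_twice_three_power:
  "{C \<in> mrs_classes n. card C = 2 * 3 ^ j} =
    (if 1 \<le> j \<and> j \<le> k - 1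
     then level_classes (k - j - 1) - {scale_class (3 ^ (k - j - 1)) (2 * 3 ^ (k - j - 1))} else {})"
  (is "?L = (if ?c then ?R else {})")
proof -
  have sub: "?c \<and> C \<in> ?R" if "C \<in> ?L" for C
  proof -
    have "C \<in> mrs_classes n" using that by blast
    then show ?thesis
    proof (cases rule: mrs_class_cases)
      case (1 m)
      then show ?thesis using that card_arithmetic_class[of m] odd_three_power_neq[of "k - m - 1" j] by simp
    next
      case (2 m)
      then have "k - m - 1 = j" using that by simp
      then have "m = k - j - 1" "?c" using 2(1) by auto
      then show ?thesis using 2(2) by simp
    qed
  qed
  show ?thesis
  proof (cases ?c)
    case True
    have "C \<in> ?L" if "C \<in> ?R" for C
    proof -
      have j: "k - j - 1 < k" "k - (k - j - 1) - 1 = j" using True by auto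
      then have "card C = 2 * 3 ^ j" using that level_class_cases[of C "k - j - 1"] by auto
      then show ?thesis using that j(1) unfolding mrs_classes_Union by blast
    qed
    then have "?L = ?R" using sub by blast
    then show ?thesis using True by simp
  next
    case False
    then have "?L = {}" using sub by blast
    then show ?thesis by (simp only: False if_False)
  qed
qed

lemma card_classes_card_twice_three_power:
  assumes "1 \<le> j" "j \<le> k - 1"
  shows "card {C \<in> mrs_classes n. card C = 2 * 3 ^ j} = 2 * 3 ^ (j - 1) - 1"
proof -
  have "k - j - 1 + 2 \<le> k" "k - (k - j - 1) - 2 = j - 1" using assms by auto
  then show ?thesis
    unfolding classes_card_twice_three_power using assms card_level_classes[of "k - j - 1"] by simp
qed

lemma E_eq: "E n = 3 ^ (k - 1)"
proof -
  \<comment> \<open>\<open>f j\<close> counts the classes of level \<open>k - Suc j\<close>: the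
    progressions and, for positive \<open>j\<close>, \<open>2 * 3 ^ (j - 1) - 1\<close> others. The
    partial sums triple at each step.\<close>
  define f :: "nat \<Rightarrow> nat" where "f j = (if j = 0 then 1 else 2 * 3 ^ (j - 1))" for j
  have level: "card (level_classes m) = f (k - Suc m)" if m: "m < k" for m
  proof -
    have eq: "card (level_classes m) = Suc (card (level_classes m - {scale_class (3 ^ m) (2 * 3 ^ m)}))"
      by (rule card.remove[OF finite_level_classes[OF m] arithmetic_class_in[OF m]])
    show ?thesis
    proof (cases "m + 2 \<le> k")
      case True
      then have "k - m - 2 = k - Suc m - 1" "k - Suc m \<noteq> 0" by auto
      then show ?thesis unfolding eq card_level_classes[OF True] by (simp add: f_def)
    next
      case False
      then have empty: "level_classes m - {scale_class (3 ^ m) (2 * 3 ^ m)} = {}"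
        using level_class_cases[OF _ m] by blast
      have "k - Suc m = 0" using False m by simp
      then show ?thesis unfolding eq empty by (simp add: f_def)
    qed
  qed
  have "E n = (\<Sum>m<k. card (level_classes m))"
    unfolding E_def mrs_classes_Union
    using finite_level_classes level_classes_disjoint by (intro card_UN_disjoint) auto
  also have "\<dots> = (\<Sum>m<k. f (k - Suc m))" using level by simp
  also have "\<dots> = (\<Sum>j<Suc (k - 1). f j)" using k by (simp add: sum.nat_diff_reindex)
  also have "\<dots> = 3 ^ (k - 1)"
  proof -
    have "(\<Sum>j<Suc i. f j) = 3 ^ i" for i
      by (induction i) (simp_all add: f_def)
    then show ?thesis .
  qed
  finally show ?thesis .
qed

text \<open>Every triple in the class has both differences divisible by \<open>3 ^ m\<close>, and
  distinct positive multiples are at best \<open>3 ^ m\<close> followed by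
  \<open>2 * 3 ^ m\<close>.\<close>

lemma least_representative_arithmetic:
  assumes m: "m < k"
  shows "least_representative n (scale_class (3 ^ m) (2 * 3 ^ m)) (1, 3 ^ m + 1, 2 * 3 ^ m + 1)"
proof -
  let ?T = "(1, 3 ^ m + 1, 2 * 3 ^ m + 1) :: nat \<times> nat \<times> nat"
  let ?C = "scale_class (3 ^ m) (2 * 3 ^ m)"
  \<comment> \<open>Minimality among all triples, not only those in \<open>D n\<close>, also shows
    that \<open>?T\<close> itself belongs to \<open>D n\<close>.\<close>
  have min: "?T \<le> T" if T: "T \<in> mrs_triples n" "mrs n T \<in> ?C" for T
  proof -
    obtain j l where jl: "T = (1, j, l)" "1 < j" "1 < l" "j \<noteq> l" "j \<le> n" "l \<le> n"
      using T(1) by (auto simp: mrs_triples_def)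
    define a b where "a = j - 1" and "b = l - 1"
    have ab: "j = a + 1" "l = b + 1" "a \<noteq> b" "0 < a" "0 < b" "a < n" "b < n"
      using jl by (auto simp: a_def b_def)
    have "mrs n T = mrs_diff n (int a) (int b)"
      using mrs_eq_mrs_diff[OF n_pos, of j l] jl by (simp add: ab)
    then obtain u where u: "\<not> 3 dvd u"
      "mrs_diff n (int a) (int b) = mrs_diff n (u * 3 ^ m) (u * (2 * 3 ^ m))"
      using T(2) by (auto simp: scale_class_def)
    have "distinct_diffs n (int a) (int b)"
      using ab by (simp add: distinct_diffs_def cong_def)
    from diff_eq_dvd[OF this diff_scale[OF distinct_diffs_three_power[OF m] u(1)] u(2), of m] m
    have "(3::int) ^ m dvd int a" "(3::int) ^ m dvd int b" by auto
    then have "int (3 ^ m) dvd int a" "int (3 ^ m) dvd int b" by simp_all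
    then obtain a' b' where ab': "a = 3 ^ m * a'" "b = 3 ^ m * b'"
      unfolding int_dvd_int_iff by (elim dvdE)
    have "a' \<ge> 1" "b' \<ge> 1" "a' \<noteq> b'" using ab ab' by auto
    then have "1 < a' \<or> 1 = a' \<and> 2 \<le> b'" by auto
    then have "3 ^ m * 1 < 3 ^ m * a' \<or> 3 ^ m * 1 = 3 ^ m * a' \<and> 3 ^ m * 2 \<le> 3 ^ m * b'"
      by (elim disjE) simp_all
    then show ?thesis unfolding jl(1) ab(1,2) ab' by auto
  qed
  have T: "mrs n ?T = mrs_diff n (3 ^ m) (2 * 3 ^ m)"
    by (subst mrs_eq_mrs_diff[OF n_pos]) simp_all
  have in_C: "mrs n ?T \<in> ?C" unfolding T by (rule scale_class_self)
  have "3 ^ Suc m \<le> n" unfolding n using m by (intro power_increasing) simp_all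
  moreover have "(1::nat) \<le> 3 ^ m" by simp
  ultimately have le: "2 * 3 ^ m + 1 \<le> n" unfolding power_Suc by linarith
  have "?T \<in> D n"
    unfolding D_def using le min in_C by auto
  moreover have "D n \<subseteq> mrs_triples n" by (auto simp: D_def mrs_triples_def)
  ultimately show ?thesis
    unfolding least_representative_def using min in_C by blast
qed

end

theorem theorem5p7:
  fixes k n :: nat
  assumes "k \<ge> 1" and "n = 3 ^ k"
  shows "E n = 3 ^ (k - 1) \<and>
    totient n = 2 * 3 ^ (k - 1) \<and>
    (\<forall>d. d dvd totient n \<and> d \<noteq> 2 \<longrightarrow> (\<exists>C \<in> mrs_classes n. card C = d)) \<and>
    \<not> (\<exists>C \<in> mrs_classes n. card C = 2) \<and>
    (\<forall>j \<le> k - 1.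
       (\<exists>!C. C \<in> mrs_classes n \<and> card C = 3 ^ j) \<and>
       (\<forall>C \<in> mrs_classes n. card C = 3 ^ j \<longrightarrow>
          least_representative n C (1, 3 ^ (k - j - 1) + 1, 2 * 3 ^ (k - j - 1) + 1))) \<and>
    (\<forall>j. 1 \<le> j \<and> j \<le> k - 1 \<longrightarrow>
       card {C \<in> mrs_classes n. card C = 2 * 3 ^ j} = 2 * 3 ^ (j - 1) - 1)"
proof -
  interpret three_power k n using assms by unfold_locales
  have tot: "totient n = 2 * 3 ^ (k - 1)"
    using totient_prime_power[of 3 k] k by (simp add: n)
  have ap: "\<exists>!C. C \<in> mrs_classes n \<and> card C = 3 ^ j" if "j \<le> k - 1" for j
    unfolding classes_card_three_power[OF that] by simp
  have "\<exists>C \<in> mrs_classes n. card C = d" if d: "d dvd totient n" "d \<noteq> 2" for d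
  proof (cases "even d")
    case True
    then obtain e where e: "d = 2 * e" by (elim evenE)
    then have "e dvd 3 ^ (k - 1)" using d(1) by (simp add: tot)
    then obtain j where j: "j \<le> k - 1" "e = 3 ^ j"
      using divides_primepow_nat[of 3 e "k - 1"] by auto
    \<comment> \<open>The exponent 0 would give \<open>d = 2\<close>.\<close>
    then have "1 \<le> j" using d(2) e by (cases j) auto
    \<comment> \<open>This makes the count \<open>2 * 3 ^ (j - 1) - 1\<close> positive, so a class
      exists.\<close>
    have "(1::nat) \<le> 3 ^ (j - 1)" by simp
    then have "card {C \<in> mrs_classes n. card C = 2 * 3 ^ j} \<noteq> 0"
      unfolding card_classes_card_twice_three_power[OF \<open>1 \<le> j\<close> j(1)] by linarith
    then have "{C \<in> mrs_classes n. card C = 2 * 3 ^ j} \<noteq> {}" by (metis card.empty)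
    then show ?thesis using e j(2) by blast
  next
    case False
    then have "d dvd 3 ^ (k - 1)"
      using d(1) by (simp add: tot coprime_dvd_mult_right_iff coprime_right_2_iff_odd)
    then obtain j where j: "j \<le> k - 1" "d = 3 ^ j"
      using divides_primepow_nat[of 3 d "k - 1"] by auto
    then show ?thesis using ap[OF j(1)] by blast
  qed
  moreover have "\<not> (\<exists>C \<in> mrs_classes n. card C = 2)"
    using classes_card_twice_three_power[of 0] by auto
  moreover have "least_representative n C (1, 3 ^ (k - j - 1) + 1, 2 * 3 ^ (k - j - 1) + 1)"
    if "j \<le> k - 1" "C \<in> mrs_classes n" "card C = 3 ^ j" for C j
  proof -
    have "C = scale_class (3 ^ (k - j - 1)) (2 * 3 ^ (k - j - 1))"
      using classes_card_three_power[OF that(1), of C] that(2,3) by blast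
    then show ?thesis using least_representative_arithmetic[of "k - j - 1"] k by simp
  qed
  ultimately show ?thesis
    using E_eq tot ap card_classes_card_twice_three_power by blast
qed

end
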